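(* Let $s>\frac12$ and let $u\in C(\mathbb R,H^s_+(\mathbb S^1))$. Then the cubic Szegő equation $$i\partial_t u=\Pi(|u|^2u)$$ is equivalent to the fact that the Hankel operator $H_u$ satisfies the evolution equation $$\frac{d}{dt}H_u=[B_u,H_u],\qquad\text{where}\qquad B_u=\frac i2H_u^2-iT_{|u|^2},$$ and $B_u$ is a skew-symmetric operator on $L^2_+(\mathbb S^1)$.
   Context: $\mathbb S^1=\{z\in\mathbb C:|z|=1\}$, with scalar product $(u|v)=\int_{\mathbb S^1}u\overline v\,\frac{d\theta}{2\pi}$ on $L^2(\mathbb S^1)$. For a space $E$ of distributions on $\mathbb S^1$, $E_+$ denotes the subspace of those $u\in E$ with Fourier coefficients $\hat u(k)=0$ for all $k<0$; thus $L^2_+$ is the Hardy space and $H^s_+=(H^s(\mathbb S^1))_+$ with $H^s$ the Sobolev space. $\Pi:L^2(\mathbb S^1)\to L^2_+(\mathbb S^1)$ is the orthogonal projector (Szegő projector). For $u\in H^{1/2}_+$, the Hankel operator of symbol $u$ is the $\mathbb C$-antilinear operator on $L^2_+$ given by $H_u(h)=\Pi(u\overline h)$; $H_u^2$ is $\mathbb C$-linear. For $b\in L^\infty(\mathbb S^1)$, the Toeplitz operator of symbol $b$ is $T_b(h)=\Pi(bh)$ on $L^2_+$. $[B,H]=BH-HB$. Skew-symmetric means $(B h_1|h_2)=-(h_1|Bh_2)$. *)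

theory Defs
  imports "HOL-Analysis.Analysis"
begin

text \<open>
  Elements of \<open>L\<^sup>2(S\<^sup>1)\<close> and of its subspaces are represented by functions \<open>complex \<Rightarrow> complex\<close>, of
  which only the values on the unit circle matter, and which are identified when they agree almost
  everywhere with respect to \<open>circ\<close>. Hence equality of elements is equality \<open>AE\<close>, and the norms below
  are seminorms on functions.
\<close>

text \<open>The normalised measure \<open>d\<theta>/2\<pi>\<close> on the unit circle.\<close>

definition circ :: "complex measure" where
  "circ = distr (uniform_measure lborel {0..2 * pi}) (restrict_space borel (sphere 0 1)) cis"

definition L2 :: "(complex \<Rightarrow> complex) set" where
  "L2 = {f. f \<in> borel_measurable circ \<and> integrable circ (\<lambda>z. (cmod (f z))\<^sup>2)}"

definition ip :: "(complex \<Rightarrow> complex) \<Rightarrow> (complex \<Rightarrow> complex) \<Rightarrow> complex" where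
  "ip f g = (LINT z|circ. f z * cnj (g z))"

definition l2norm :: "(complex \<Rightarrow> complex) \<Rightarrow> real" where
  "l2norm f = sqrt (LINT z|circ. (cmod (f z))\<^sup>2)"

definition fourier :: "(complex \<Rightarrow> complex) \<Rightarrow> int \<Rightarrow> complex" where
  "fourier f k = ip f (\<lambda>z. z powi k)"

definition plus_part :: "(complex \<Rightarrow> complex) set \<Rightarrow> (complex \<Rightarrow> complex) set" where
  "plus_part E = {f \<in> E. \<forall>k<0. fourier f k = 0}"

abbreviation L2_plus :: "(complex \<Rightarrow> complex) set" where
  "L2_plus \<equiv> plus_part L2"

text \<open>The Sobolev space \<open>H\<^sup>s\<close>; only \<open>s \<ge> 0\<close> is meant, where all its elements are in \<open>L\<^sup>2\<close>.\<close>

definition Hs :: "real \<Rightarrow> (complex \<Rightarrow> complex) set" where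
  "Hs s = {f \<in> L2. (\<lambda>k. (1 + (real_of_int k)\<^sup>2) powr s * (cmod (fourier f k))\<^sup>2) summable_on UNIV}"

definition hs_norm :: "real \<Rightarrow> (complex \<Rightarrow> complex) \<Rightarrow> real" where
  "hs_norm s f = sqrt (\<Sum>\<^sub>\<infinity>k. (1 + (real_of_int k)\<^sup>2) powr s * (cmod (fourier f k))\<^sup>2)"

abbreviation Hs_plus :: "real \<Rightarrow> (complex \<Rightarrow> complex) set" where
  "Hs_plus s \<equiv> plus_part (Hs s)"

text \<open>
  The orthogonal projection of \<open>f \<in> L\<^sup>2\<close> onto \<open>L\<^sup>2\<^sub>+\<close> is unique up to equality \<open>AE\<close>. The selected
  representative is the same for functions \<open>f\<close> that agree \<open>AE\<close>, as they satisfy the same predicate.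
\<close>

definition szego_proj :: "(complex \<Rightarrow> complex) \<Rightarrow> complex \<Rightarrow> complex" where
  "szego_proj f = (SOME g. g \<in> L2_plus \<and> (\<forall>h\<in>L2_plus. ip (\<lambda>z. f z - g z) h = 0))"

text \<open>
  Operators on \<open>L\<^sup>2\<^sub>+\<close> are functions that are only meaningful on \<open>L2_plus\<close>. The Hankel operator is used
  for symbols in \<open>H\<^sup>s\<^sub>+\<close> with \<open>s > 1/2\<close>; these are essentially bounded, so the product is in \<open>L\<^sup>2\<close>.
\<close>

type_synonym operator = "(complex \<Rightarrow> complex) \<Rightarrow> complex \<Rightarrow> complex"

definition hankel :: "(complex \<Rightarrow> complex) \<Rightarrow> operator" where
  "hankel u h = szego_proj (\<lambda>z. u z * cnj (h z))"

definition toeplitz :: "(complex \<Rightarrow> complex) \<Rightarrow> operator" where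
  "toeplitz b h = szego_proj (\<lambda>z. b z * h z)"

definition commutator :: "operator \<Rightarrow> operator \<Rightarrow> operator" where
  "commutator A C h = (\<lambda>z. A (C h) z - C (A h) z)"

definition B_op :: "(complex \<Rightarrow> complex) \<Rightarrow> operator" where
  "B_op u h = (\<lambda>z. \<i> / 2 * hankel u (hankel u h) z
      - \<i> * toeplitz (\<lambda>w. of_real ((cmod (u w))\<^sup>2)) h z)"

definition linear_op :: "operator \<Rightarrow> bool" where
  "linear_op A \<longleftrightarrow> (\<forall>h\<in>L2_plus. A h \<in> L2_plus) \<and>
    (\<forall>h\<in>L2_plus. \<forall>g\<in>L2_plus. \<forall>a b.
      AE z in circ. A (\<lambda>w. a * h w + b * g w) z = a * A h z + b * A g z)"

definition skew_symmetric_op :: "operator \<Rightarrow> bool" where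
  "skew_symmetric_op A \<longleftrightarrow> linear_op A \<and>
    (\<forall>h1\<in>L2_plus. \<forall>h2\<in>L2_plus. ip (A h1) h2 = - ip h1 (A h2))"

definition C_Hs_plus :: "real \<Rightarrow> (real \<Rightarrow> complex \<Rightarrow> complex) set" where
  "C_Hs_plus s = {u. (\<forall>t. u t \<in> Hs_plus s) \<and>
    (\<forall>t. ((\<lambda>\<tau>. hs_norm s (\<lambda>z. u \<tau> z - u t z)) \<longlongrightarrow> 0) (at t))}"

text \<open>
  The equation and the evolution of the Hankel operator are understood in the classical sense: time
  derivatives are limits of difference quotients, in the norm of \<open>H\<^sup>s\<^sub>+\<close> respectively in the operator
  norm of \<open>L\<^sup>2\<^sub>+\<close>. The membership conditions on the derivative prevent the default values of
  divergent sums and integrals from entering.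
\<close>

definition has_Hs_derivative ::
  "real \<Rightarrow> (real \<Rightarrow> complex \<Rightarrow> complex) \<Rightarrow> (complex \<Rightarrow> complex) \<Rightarrow> real \<Rightarrow> bool" where
  "has_Hs_derivative s u v t \<longleftrightarrow> v \<in> Hs_plus s \<and>
    ((\<lambda>r. hs_norm s (\<lambda>z. (u (t + r) z - u t z) / of_real r - v z)) \<longlongrightarrow> 0) (at 0)"

definition has_op_derivative :: "(real \<Rightarrow> operator) \<Rightarrow> operator \<Rightarrow> real \<Rightarrow> bool" where
  "has_op_derivative A D t \<longleftrightarrow> (\<forall>h\<in>L2_plus. D h \<in> L2_plus) \<and>
    (\<forall>\<epsilon>>0. \<forall>\<^sub>F r in at 0. \<forall>h\<in>L2_plus.
      l2norm (\<lambda>z. (A (t + r) h z - A t h z) / of_real r - D h z) \<le> \<epsilon> * l2norm h)"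

definition cubic_szego_solution :: "real \<Rightarrow> (real \<Rightarrow> complex \<Rightarrow> complex) \<Rightarrow> bool" where
  "cubic_szego_solution s u \<longleftrightarrow> (\<forall>t. \<exists>v. has_Hs_derivative s u v t \<and>
    (AE z in circ. \<i> * v z = szego_proj (\<lambda>w. of_real ((cmod (u t w))\<^sup>2) * u t w) z))"

end

theory Submission
  imports Defs
begin

text \<open>
  On \<open>L2_plus\<close> a Hankel operator sees only the nonnegative frequencies of its symbol, so that
  \<open>[B\<^sub>u, H\<^sub>u]\<close> is again a Hankel operator, with symbol \<open>F(u) = -i \<Pi>(|u|\<^sup>2 u)\<close>.
  If \<open>u\<close> solves the equation, the bound of the operator norm of \<open>H\<^sub>w\<close> by the \<open>H\<^sup>s\<close> norm of \<open>w\<close>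
  turns the derivative of \<open>u\<close> into that of \<open>H\<^sub>u\<close>. Conversely, \<open>H\<^sub>u 1 = u\<close>, so the Lax equation
  applied to \<open>1\<close> only gives \<open>u' = F(u)\<close> in \<open>L\<^sup>2\<close>, hence for each Fourier coefficient; since \<open>H\<^sup>s\<close> is an
  algebra, \<open>F(u)\<close> is continuous in \<open>H\<^sup>s\<close>, and the mean value theorem lifts the derivative to \<open>H\<^sup>s\<close>.
\<close>

subsection \<open>The normalised measure on the circle\<close>

text \<open>Antilinearity explains the factor 1/2 in \<open>B_op\<close>: as
  \<open>H(i A) = -i H A\<close>, the two terms coming from \<open>i/2 H^2\<close> add up in
  \<open>[B,H]\<close> instead of cancelling, and \<open>[B,H] = -i (T H + H T - H^3)\<close> with
  \<open>T\<close> the Toeplitz operator of symbol |u|^2. The bracket is the Hankel operator of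
  symbol |u|^2 u. The obstacle in the converse is that the Lax equation controls difference
  quotients of \<open>u\<close> only in L^2, too weak a norm for a derivative in H^s. What helps is
  that the H^s norm is bounded as soon as all finite partial sums of weighted coefficients are, with
  one common bound, and each such sum involves finitely many scalar functions of time. Since
  elements are functions up to AE and \<open>szego_proj\<close> is a choice, identities between
  operators are checked on the Fourier coefficients with k >= 0. This rests on uniqueness of Fourier
  coefficients, on Riesz-Fischer for the existence of the projection, and on the convolution formula
  for products, which holds because the symbols have absolutely convergent Fourier series.\<close>

lemma space_circ [simp]: "space circ = sphere 0 1"
  by (simp add: circ_def space_restrict_space)

lemma sets_circ: "sets circ = sets (restrict_space borel (sphere 0 1))"
  by (simp add: circ_def)

lemma borel_measurable_circ:
  "borel_measurable circ = borel_measurable (restrict_space borel (sphere 0 1 :: complex set))"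
  by (intro measurable_cong_sets sets_circ refl)

lemma borel_measurable_circ_continuous:
  "continuous_on (sphere 0 1) f \<Longrightarrow> f \<in> borel_measurable circ"
  unfolding borel_measurable_circ by (rule borel_measurable_continuous_on_restrict)

lemma measurable_cis_circ:
  "cis \<in> uniform_measure lborel {0..2 * pi} \<rightarrow>\<^sub>M restrict_space borel (sphere 0 1)"
proof -
  have "cis \<in> borel_measurable borel"
    by (intro borel_measurable_continuous_onI continuous_intros)
  moreover have "borel_measurable (uniform_measure lborel {0..2 * pi}) = borel_measurable borel"
    by (rule measurable_cong_sets) auto
  ultimately have "cis \<in> borel_measurable (uniform_measure lborel {0..2 * pi})"
    by blast
  then show ?thesis
    by (intro measurable_restrict_space2) simp_all
qed

lemma finite_measure_circ: "finite_measure circ"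
  and measure_circ_space: "measure circ (sphere 0 1) = 1"
proof -
  have 1: "emeasure circ (space circ) = 1"
  proof -
    have "emeasure (uniform_measure lborel {0..2 * pi}) UNIV = 1"
      by (subst emeasure_uniform_measure) (simp_all add: ennreal_divide_self)
    moreover have "cis -` sphere 0 1 \<inter> space (uniform_measure lborel {0..2 * pi}) = UNIV"
      by auto
    moreover have "sphere 0 1 \<in> sets (restrict_space borel (sphere 0 1 :: complex set))"
      using sets.top[of "restrict_space borel (sphere 0 1 :: complex set)"]
      by (simp add: space_restrict_space)
    ultimately show ?thesis
      unfolding space_circ unfolding circ_def
      by (subst emeasure_distr[OF measurable_cis_circ]) simp_all
  qed
  show "finite_measure circ" by (rule finite_measureI) (simp add: 1 del: space_circ)
  show "measure circ (sphere 0 1) = 1" using 1 by (simp add: measure_def)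
qed

interpretation circ: finite_measure circ
  by (rule finite_measure_circ)

lemma AE_circ_norm: "AE z in circ. cmod z = 1"
  by (rule AE_I2) simp

lemma integral_circ:
  fixes f :: "complex \<Rightarrow> complex"
  assumes [measurable]: "f \<in> borel_measurable circ"
  shows "(LINT z|circ. f z) = (LINT x|lborel. indicator {0..2 * pi} x *\<^sub>R f (cis x)) / of_real (2 * pi)"
proof -
  have f: "f \<in> borel_measurable (restrict_space borel (sphere 0 1))"
    using assms by (simp add: borel_measurable_circ)
  have "(LINT z|circ. f z) = (LINT x|uniform_measure lborel {0..2 * pi}. f (cis x))"
    unfolding circ_def by (rule integral_distr[OF measurable_cis_circ f])
  also have "uniform_measure lborel {0..2 * pi} =
      density lborel (\<lambda>x. ennreal (indicator {0..2 * pi} x / (2 * pi)))"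
    unfolding uniform_measure_def
  proof (intro density_cong AE_I2)
    show "indicator {0..2 * pi} x / emeasure lborel {0..2 * pi} =
        ennreal (indicator {0..2 * pi} x / (2 * pi))" for x :: real
      using divide_ennreal[of 1 "2 * pi"] by (cases "x \<in> {0..2 * pi}") simp_all
  qed auto
  also have "(LINT x|\<dots>. f (cis x)) = (LINT x|lborel. (indicator {0..2 * pi} x / (2 * pi)) *\<^sub>R f (cis x))"
  proof (rule integral_density)
    have "borel_measurable (uniform_measure lborel {0..2 * pi}) = borel_measurable lborel"
      by (rule measurable_cong_sets) auto
    then show "(\<lambda>x. f (cis x)) \<in> borel_measurable lborel"
      using measurable_compose[OF measurable_cis_circ f] by blast
  qed auto
  also have "\<dots> = (LINT x|lborel. (indicator {0..2 * pi} x *\<^sub>R f (cis x)) / of_real (2 * pi))"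
    by (simp add: scaleR_conv_of_real)
  finally show ?thesis by simp
qed

lemma continuous_on_powi: "continuous_on (sphere 0 1) (\<lambda>z::complex. z powi k)"
  by (rule continuous_on_power_int) (auto intro: continuous_intros)

lemma borel_measurable_powi [measurable]: "(\<lambda>z. z powi k) \<in> borel_measurable circ"
  by (intro borel_measurable_circ_continuous continuous_on_powi)

lemma integral_powi: "(LINT z|circ. z powi k) = (if k = 0 then 1 else 0)"
proof (cases "k = 0")
  case True
  then show ?thesis by (simp add: measure_circ_space)
next
  case False
  have "(LINT x|lborel. indicator {0..2 * pi} x *\<^sub>R cis (of_int k * x)) =
      cis (of_int k * (2 * pi)) / (\<i> * of_int k) - cis (of_int k * 0) / (\<i> * of_int k)"
  proof (rule integral_FTC_atLeastAtMost)
    show "((\<lambda>x. cis (of_int k * x) / (\<i> * of_int k)) has_vector_derivative cis (of_int k * x))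
        (at x within {0..2 * pi})" for x
    proof -
      have "((\<lambda>x. exp (\<i> * of_real (of_int k * x)) / (\<i> * of_int k)) has_vector_derivative
          exp (\<i> * of_real (of_int k * x))) (at x within {0..2 * pi})"
        using False
        by (auto intro!: derivative_eq_intros has_vector_derivative_real_field simp: mult_ac)
      then show ?thesis by (simp add: cis_conv_exp)
    qed
  qed (auto intro!: continuous_intros)
  also have "cis (of_int k * (2 * pi)) = 1"
    using cis_multiple_2pi[of "of_int k"] by (simp only: mult.commute[of "of_int k"] Ints_of_int)
  finally show ?thesis
    using False unfolding integral_circ[OF borel_measurable_powi] cis_power_int by simp
qed

subsection \<open>The space \<open>L\<^sup>2\<close>\<close>

lemma borel_measurable_cnj [measurable]: "cnj \<in> borel_measurable borel"
  by (intro borel_measurable_continuous_onI continuous_intros)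

lemma L2_measurable [measurable_dest]: "f \<in> L2 \<Longrightarrow> f \<in> borel_measurable circ"
  and L2_integrable: "f \<in> L2 \<Longrightarrow> integrable circ (\<lambda>z. (cmod (f z))\<^sup>2)"
  by (auto simp: L2_def)

lemma L2_I_bound:
  assumes "f \<in> borel_measurable circ" "integrable circ g" "AE z in circ. (cmod (f z))\<^sup>2 \<le> g z"
  shows "f \<in> L2"
proof -
  have "integrable circ (\<lambda>z. (cmod (f z))\<^sup>2)"
  proof (rule Bochner_Integration.integrable_bound[OF assms(2)])
    show "AE z in circ. norm ((cmod (f z))\<^sup>2) \<le> norm (g z)"
      using assms(3) by eventually_elim simp
  qed (use assms(1) in measurable)
  with assms(1) show ?thesis by (simp add: L2_def)
qed

lemma L2_cong_AE:
  assumes "f \<in> borel_measurable circ" "g \<in> L2" "AE z in circ. f z = g z"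
  shows "f \<in> L2"
  using assms(3) by (intro L2_I_bound[OF assms(1) L2_integrable[OF assms(2)]]) auto

lemma L2_scale: "f \<in> L2 \<Longrightarrow> (\<lambda>z. c * f z) \<in> L2"
  by (auto simp: L2_def norm_mult power_mult_distrib)

lemma L2_cnj: "f \<in> L2 \<Longrightarrow> (\<lambda>z. cnj (f z)) \<in> L2"
  using measurable_compose[OF L2_measurable borel_measurable_cnj, of f] by (simp add: L2_def)

lemma L2_add:
  assumes [measurable]: "f \<in> L2" "g \<in> L2"
  shows "(\<lambda>z. f z + g z) \<in> L2"
proof (rule L2_I_bound)
  show "integrable circ (\<lambda>z. 2 * (cmod (f z))\<^sup>2 + 2 * (cmod (g z))\<^sup>2)"
    using assms by (auto intro!: L2_integrable)
  have "(cmod (f z + g z))\<^sup>2 \<le> 2 * (cmod (f z))\<^sup>2 + 2 * (cmod (g z))\<^sup>2" for z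
  proof -
    have "(cmod (f z + g z))\<^sup>2 \<le> (cmod (f z) + cmod (g z))\<^sup>2"
      by (intro power_mono norm_triangle_ineq) auto
    also have "\<dots> \<le> 2 * (cmod (f z))\<^sup>2 + 2 * (cmod (g z))\<^sup>2"
      using sum_squares_bound[of "cmod (f z)" "cmod (g z)"] by (simp add: power2_sum)
    finally show ?thesis .
  qed
  then show "AE z in circ. (cmod (f z + g z))\<^sup>2 \<le> 2 * (cmod (f z))\<^sup>2 + 2 * (cmod (g z))\<^sup>2" by simp
qed measurable

lemma L2_diff: "f \<in> L2 \<Longrightarrow> g \<in> L2 \<Longrightarrow> (\<lambda>z. f z - g z) \<in> L2"
  using L2_add[OF _ L2_scale[of g "-1"], of f] by simp

lemma L2_const: "(\<lambda>z. c) \<in> L2"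
  by (simp add: L2_def)

lemma L2_sum: "(\<And>i. i \<in> I \<Longrightarrow> f i \<in> L2) \<Longrightarrow> (\<lambda>z. \<Sum>i\<in>I. f i z) \<in> L2"
  by (induction I rule: infinite_finite_induct) (auto intro: L2_const L2_add)

lemma L2_bounded_mult:
  assumes [measurable]: "b \<in> borel_measurable circ" "f \<in> L2"
    and b: "AE z in circ. cmod (b z) \<le> C"
  shows "(\<lambda>z. b z * f z) \<in> L2"
proof (rule L2_I_bound)
  show "integrable circ (\<lambda>z. C\<^sup>2 * (cmod (f z))\<^sup>2)"
    using assms by (auto intro!: L2_integrable)
  show "AE z in circ. (cmod (b z * f z))\<^sup>2 \<le> C\<^sup>2 * (cmod (f z))\<^sup>2"
    using b by eventually_elim (auto simp: norm_mult power_mult_distrib intro!: mult_right_mono power_mono)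
qed measurable

lemma L2_powi: "(\<lambda>z. z powi k) \<in> L2"
  by (rule L2_I_bound[where g = "\<lambda>_. 1"]) (use AE_circ_norm in \<open>auto simp: norm_power_int\<close>)

lemma L2_powi_mult: "f \<in> L2 \<Longrightarrow> (\<lambda>z. z powi k * f z) \<in> L2"
  by (rule L2_bounded_mult[where C = 1]) (use AE_circ_norm in \<open>auto simp: norm_power_int\<close>)

lemma integrable_L2_mult:
  assumes [measurable]: "f \<in> L2" "g \<in> L2"
  shows "integrable circ (\<lambda>z. f z * g z)"
proof (rule Bochner_Integration.integrable_bound)
  show "integrable circ (\<lambda>z. (cmod (f z))\<^sup>2 + (cmod (g z))\<^sup>2)"
    using assms by (auto intro!: L2_integrable)
  have "cmod (f z) * cmod (g z) \<le> (cmod (f z))\<^sup>2 + (cmod (g z))\<^sup>2" for z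
    using sum_squares_bound[of "cmod (f z)" "cmod (g z)"]
      mult_nonneg_nonneg[OF norm_ge_zero norm_ge_zero, of "f z" "g z"] by linarith
  then show "AE z in circ. norm (f z * g z) \<le> norm ((cmod (f z))\<^sup>2 + (cmod (g z))\<^sup>2)"
    by (simp add: norm_mult)
qed measurable

lemma integrable_L2: "f \<in> L2 \<Longrightarrow> integrable circ f"
  using integrable_L2_mult[OF _ L2_const[of 1], of f] by simp

lemma integrable_ip: "f \<in> L2 \<Longrightarrow> g \<in> L2 \<Longrightarrow> integrable circ (\<lambda>z. f z * cnj (g z))"
  by (intro integrable_L2_mult L2_cnj)

lemma ip_add_left: "f \<in> L2 \<Longrightarrow> g \<in> L2 \<Longrightarrow> h \<in> L2 \<Longrightarrow> ip (\<lambda>z. f z + g z) h = ip f h + ip g h"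
  by (simp add: ip_def ring_distribs integrable_ip)

lemma ip_diff_left: "f \<in> L2 \<Longrightarrow> g \<in> L2 \<Longrightarrow> h \<in> L2 \<Longrightarrow> ip (\<lambda>z. f z - g z) h = ip f h - ip g h"
  by (simp add: ip_def ring_distribs integrable_ip)

lemma ip_scale_left: "ip (\<lambda>z. c * f z) h = c * ip f h"
  by (simp add: ip_def mult.assoc)

lemma ip_sum_left:
  "(\<And>i. i \<in> I \<Longrightarrow> f i \<in> L2) \<Longrightarrow> h \<in> L2 \<Longrightarrow> ip (\<lambda>z. \<Sum>i\<in>I. f i z) h = (\<Sum>i\<in>I. ip (f i) h)"
  by (simp add: ip_def sum_distrib_right integrable_ip)

lemma ip_commute: "ip f g = cnj (ip g f)"
  unfolding ip_def by (subst Bochner_Integration.integral_cnj[symmetric]) (simp add: mult.commute)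

lemma ip_cong_AE:
  assumes [measurable]: "f \<in> borel_measurable circ" "f' \<in> borel_measurable circ"
      "g \<in> borel_measurable circ" "g' \<in> borel_measurable circ"
    and "AE z in circ. f z = f' z" "AE z in circ. g z = g' z"
  shows "ip f g = ip f' g'"
  unfolding ip_def using assms(5,6) by (intro integral_cong_AE) auto

lemma l2norm_nonneg [simp]: "l2norm f \<ge> 0"
  by (simp add: l2norm_def)

lemma l2norm_power2: "(l2norm f)\<^sup>2 = (LINT z|circ. (cmod (f z))\<^sup>2)"
  by (simp add: l2norm_def)

lemma ip_self: "ip f f = of_real ((l2norm f)\<^sup>2)"
  unfolding ip_def l2norm_power2 complex_norm_square[symmetric] by (rule integral_complex_of_real)

lemma l2norm_cong_AE:
  assumes [measurable]: "f \<in> borel_measurable circ" "g \<in> borel_measurable circ"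
    and "AE z in circ. f z = g z"
  shows "l2norm f = l2norm g"
  unfolding l2norm_def using assms(3) by (intro arg_cong[where f = sqrt] integral_cong_AE) auto

lemma l2norm_minus: "l2norm (\<lambda>z. f z - g z) = l2norm (\<lambda>z. g z - f z)"
  by (simp add: l2norm_def norm_minus_commute)

lemma l2norm_eq_0D:
  assumes [measurable]: "f \<in> L2" and "l2norm f = 0"
  shows "AE z in circ. f z = 0"
proof -
  have "(LINT z|circ. (cmod (f z))\<^sup>2) = 0"
    using assms(2) by (simp add: l2norm_def)
  then have "AE z in circ. (cmod (f z))\<^sup>2 = 0"
    using assms by (subst (asm) integral_nonneg_eq_0_iff_AE) (auto intro: L2_integrable)
  then show ?thesis by simp
qed

lemma l2norm_mono_bound:
  assumes [measurable]: "f \<in> borel_measurable circ" "g \<in> L2"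
    and "AE z in circ. cmod (f z) \<le> C * cmod (g z)" "C \<ge> 0"
  shows "l2norm f \<le> C * l2norm g"
proof -
  have "f \<in> L2"
  proof (rule L2_I_bound)
    show "integrable circ (\<lambda>z. C\<^sup>2 * (cmod (g z))\<^sup>2)"
      using assms by (auto intro!: L2_integrable)
    show "AE z in circ. (cmod (f z))\<^sup>2 \<le> C\<^sup>2 * (cmod (g z))\<^sup>2"
      using assms(3) by eventually_elim (metis norm_ge_zero power_mono power_mult_distrib)
  qed measurable
  then have "(l2norm f)\<^sup>2 \<le> (LINT z|circ. C\<^sup>2 * (cmod (g z))\<^sup>2)"
    unfolding l2norm_power2
  proof (intro integral_mono_AE)
    show "AE z in circ. (cmod (f z))\<^sup>2 \<le> C\<^sup>2 * (cmod (g z))\<^sup>2"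
      using assms(3) by eventually_elim (metis norm_ge_zero power_mono power_mult_distrib)
  qed (auto intro!: L2_integrable assms)
  then have "(l2norm f)\<^sup>2 \<le> (C * l2norm g)\<^sup>2"
    by (simp add: power_mult_distrib l2norm_power2)
  then show ?thesis using assms(4) by (simp add: power2_le_iff_abs_le)
qed

lemma integral_norm_le_l2norm:
  assumes [measurable]: "f \<in> L2" "g \<in> L2"
  shows "(LINT z|circ. cmod (f z) * cmod (g z)) \<le> l2norm f * l2norm g"
proof (cases "l2norm f = 0 \<or> l2norm g = 0")
  case True
  then have "AE z in circ. f z * g z = 0"
    using l2norm_eq_0D[OF assms(1)] l2norm_eq_0D[OF assms(2)] by auto
  then have "(LINT z|circ. cmod (f z) * cmod (g z)) = (LINT z|circ. 0)"
    by (intro integral_cong_AE) auto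
  then show ?thesis by simp
next
  case False
  then have pos: "l2norm f > 0" "l2norm g > 0"
    by (auto simp: less_le)
  \<comment> \<open>With this weight the inequality 2 x y <= c x^2 + y^2 / c integrates to exactly
    the product of the two norms.\<close>
  define c where "c = l2norm g / l2norm f"
  have c: "c > 0" using pos by (simp add: c_def)
  have "(LINT z|circ. cmod (f z) * cmod (g z)) \<le>
      (LINT z|circ. c / 2 * (cmod (f z))\<^sup>2 + 1 / (2 * c) * (cmod (g z))\<^sup>2)"
  proof (rule integral_mono)
    show "integrable circ (\<lambda>z. cmod (f z) * cmod (g z))"
      using integrable_norm[OF integrable_L2_mult[OF assms]] by (simp add: norm_mult)
    show "integrable circ (\<lambda>z. c / 2 * (cmod (f z))\<^sup>2 + 1 / (2 * c) * (cmod (g z))\<^sup>2)"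
      using assms by (intro Bochner_Integration.integrable_add integrable_mult_right L2_integrable)
    show "cmod (f z) * cmod (g z) \<le> c / 2 * (cmod (f z))\<^sup>2 + 1 / (2 * c) * (cmod (g z))\<^sup>2" for z
      using zero_le_power2[of "c * cmod (f z) - cmod (g z)"] c
      by (simp add: field_simps power2_eq_square)
  qed
  also have "\<dots> = c / 2 * (l2norm f)\<^sup>2 + 1 / (2 * c) * (l2norm g)\<^sup>2"
    using assms by (simp add: l2norm_power2 L2_integrable)
  also have "\<dots> = l2norm f * l2norm g"
    using pos by (simp add: c_def field_simps power2_eq_square)
  finally show ?thesis .
qed

lemma norm_ip_le:
  assumes "f \<in> L2" "g \<in> L2"
  shows "cmod (ip f g) \<le> l2norm f * l2norm g"
proof -
  have "cmod (ip f g) \<le> (LINT z|circ. cmod (f z * cnj (g z)))"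
    unfolding ip_def by (rule integral_norm_bound)
  with integral_norm_le_l2norm[OF assms] show ?thesis by (simp add: norm_mult)
qed

lemma l2norm_triangle:
  assumes "f \<in> L2" "g \<in> L2"
  shows "l2norm (\<lambda>z. f z + g z) \<le> l2norm f + l2norm g"
proof -
  have "(LINT z|circ. (cmod (f z + g z))\<^sup>2) \<le>
      (LINT z|circ. (cmod (f z))\<^sup>2 + 2 * (cmod (f z) * cmod (g z)) + (cmod (g z))\<^sup>2)"
  proof (rule integral_mono)
    show "integrable circ (\<lambda>z. (cmod (f z + g z))\<^sup>2)"
      by (intro L2_integrable L2_add assms)
    show "integrable circ (\<lambda>z. (cmod (f z))\<^sup>2 + 2 * (cmod (f z) * cmod (g z)) + (cmod (g z))\<^sup>2)"
      using integrable_norm[OF integrable_L2_mult[OF assms]] assms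
      by (intro Bochner_Integration.integrable_add integrable_mult_right L2_integrable)
         (simp_all add: norm_mult)
    show "(cmod (f z + g z))\<^sup>2 \<le> (cmod (f z))\<^sup>2 + 2 * (cmod (f z) * cmod (g z)) + (cmod (g z))\<^sup>2" for z
      using power_mono[OF norm_triangle_ineq[of "f z" "g z"], of 2] by (simp add: power2_sum)
  qed
  also have "\<dots> = (l2norm f)\<^sup>2 + 2 * (LINT z|circ. cmod (f z) * cmod (g z)) + (l2norm g)\<^sup>2"
    using integrable_norm[OF integrable_L2_mult[OF assms]] assms
    by (simp add: l2norm_power2 L2_integrable norm_mult)
  also have "\<dots> \<le> (l2norm f)\<^sup>2 + 2 * (l2norm f * l2norm g) + (l2norm g)\<^sup>2"
    using integral_norm_le_l2norm[OF assms] by simp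
  also have "\<dots> = (l2norm f + l2norm g)\<^sup>2" by (simp add: power2_sum)
  finally have "(l2norm (\<lambda>z. f z + g z))\<^sup>2 \<le> (l2norm f + l2norm g)\<^sup>2"
    by (simp add: l2norm_power2)
  then show ?thesis by (rule power2_le_imp_le) simp
qed

subsection \<open>Fourier coefficients\<close>

lemma cnj_powi_circle:
  assumes "cmod z = 1"
  shows "cnj z powi k = z powi (- k)"
proof -
  have "z * cnj z = 1"
    using assms complex_norm_square[of z] by simp
  then have "cnj z = inverse z"
    by (metis inverse_unique)
  then show ?thesis by (simp add: power_int_inverse power_int_minus)
qed

lemma fourier_eq: "fourier f k = (LINT z|circ. z powi (- k) * f z)"
  unfolding fourier_def ip_def
  by (intro Bochner_Integration.integral_cong) (auto simp: cnj_powi_circle)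

lemma ip_powi_powi: "ip (\<lambda>z. z powi j) (\<lambda>z. z powi k) = (if j = k then 1 else 0)"
proof -
  have "ip (\<lambda>z. z powi j) (\<lambda>z. z powi k) = (LINT z|circ. z powi (j - k))"
    unfolding ip_def
  proof (intro Bochner_Integration.integral_cong refl)
    fix z :: complex assume "z \<in> space circ"
    then have "cmod z = 1" "z \<noteq> 0" by auto
    then show "z powi j * cnj (z powi k) = z powi (j - k)"
      by (simp add: cnj_powi_circle power_int_diff power_int_minus divide_inverse)
  qed
  then show ?thesis by (simp add: integral_powi)
qed

lemma fourier_powi: "fourier (\<lambda>z. z powi j) k = (if j = k then 1 else 0)"
  by (simp add: fourier_def ip_powi_powi)

lemma fourier_add: "f \<in> L2 \<Longrightarrow> g \<in> L2 \<Longrightarrow> fourier (\<lambda>z. f z + g z) k = fourier f k + fourier g k"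
  by (simp add: fourier_def ip_add_left L2_powi)

lemma fourier_diff: "f \<in> L2 \<Longrightarrow> g \<in> L2 \<Longrightarrow> fourier (\<lambda>z. f z - g z) k = fourier f k - fourier g k"
  by (simp add: fourier_def ip_diff_left L2_powi)

lemma fourier_scale: "fourier (\<lambda>z. c * f z) k = c * fourier f k"
  by (simp add: fourier_def ip_scale_left)

lemma fourier_powi_mult: "fourier (\<lambda>z. z powi j * f z) k = fourier f (k - j)"
  unfolding fourier_eq
proof (intro Bochner_Integration.integral_cong refl)
  fix z :: complex assume "z \<in> space circ"
  then have "z \<noteq> 0" by auto
  then show "z powi - k * (z powi j * f z) = z powi - (k - j) * f z"
    by (simp add: power_int_add[symmetric] mult.assoc[symmetric])
qed

lemma fourier_cnj: "fourier (\<lambda>z. cnj (f z)) k = cnj (fourier f (- k))"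
  unfolding fourier_eq Bochner_Integration.integral_cnj[symmetric]
  by (intro Bochner_Integration.integral_cong) (auto simp: cnj_powi_circle)

lemma fourier_cong_AE:
  assumes "f \<in> borel_measurable circ" "g \<in> borel_measurable circ" "AE z in circ. f z = g z"
  shows "fourier f k = fourier g k"
  unfolding fourier_def by (rule ip_cong_AE) (use assms in auto)

lemma l2norm_powi: "l2norm (\<lambda>z. z powi k) = 1"
proof -
  have "complex_of_real ((l2norm (\<lambda>z. z powi k))\<^sup>2) = 1"
    by (simp only: ip_self[symmetric] ip_powi_powi simp_thms if_True)
  then have "(l2norm (\<lambda>z. z powi k))\<^sup>2 = 1"
    by (metis of_real_eq_1_iff)
  then show ?thesis
    using l2norm_nonneg[of "\<lambda>z. z powi k"] by (simp add: power2_eq_1_iff)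
qed

lemma norm_fourier_le: "f \<in> L2 \<Longrightarrow> cmod (fourier f k) \<le> l2norm f"
  using norm_ip_le[OF _ L2_powi, of f k] by (simp add: fourier_def l2norm_powi)

lemma L2_trig: "(\<lambda>z. \<Sum>k\<in>K. c k * z powi k) \<in> L2"
  by (intro L2_sum L2_scale L2_powi)

lemma ip_trig: "h \<in> L2 \<Longrightarrow> ip (\<lambda>z. \<Sum>k\<in>K. c k * z powi k) h = (\<Sum>k\<in>K. c k * cnj (fourier h k))"
  by (subst ip_sum_left)
     (auto intro!: L2_scale L2_powi simp: ip_scale_left ip_commute[of _ h] fourier_def)

lemma fourier_trig:
  "finite K \<Longrightarrow> fourier (\<lambda>z. \<Sum>k\<in>K. c k * z powi k) j = (if j \<in> K then c j else 0)"
  unfolding fourier_def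
  by (subst ip_sum_left) (auto intro!: L2_scale L2_powi simp: ip_scale_left ip_powi_powi if_distrib cong: if_cong)

lemma l2norm_trig:
  assumes "finite K"
  shows "(l2norm (\<lambda>z. \<Sum>k\<in>K. c k * z powi k))\<^sup>2 = (\<Sum>k\<in>K. (cmod (c k))\<^sup>2)"
proof -
  have "complex_of_real ((l2norm (\<lambda>z. \<Sum>k\<in>K. c k * z powi k))\<^sup>2) = of_real (\<Sum>k\<in>K. (cmod (c k))\<^sup>2)"
    unfolding ip_self[symmetric] using assms
    by (simp add: ip_trig L2_trig fourier_trig complex_norm_square[symmetric] del: of_real_power)
  then show ?thesis by (simp only: of_real_eq_iff)
qed

lemma bessel:
  assumes "f \<in> L2" "finite K"
  shows "(\<Sum>k\<in>K. (cmod (fourier f k))\<^sup>2) \<le> (l2norm f)\<^sup>2"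
proof -
  \<comment> \<open>The orthogonal projection of \<open>f\<close> onto the frequencies in
    \<open>K\<close>: it satisfies (p|f) = (p|p), so Cauchy-Schwarz bounds its norm by that of
    \<open>f\<close>.\<close>
  define p where "p = (\<lambda>z. \<Sum>k\<in>K. fourier f k * z powi k)"
  have p: "p \<in> L2" unfolding p_def by (rule L2_trig)
  have eq: "(l2norm p)\<^sup>2 = (\<Sum>k\<in>K. (cmod (fourier f k))\<^sup>2)"
    unfolding p_def by (rule l2norm_trig[OF assms(2)])
  have "ip p f = of_real ((l2norm p)\<^sup>2)"
    unfolding eq unfolding p_def using assms
    by (simp add: ip_trig complex_norm_square[symmetric] del: of_real_power)
  then have "(l2norm p)\<^sup>2 = cmod (ip p f)"
    by (simp add: norm_power)
  also have "\<dots> \<le> l2norm p * l2norm f"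
    by (rule norm_ip_le[OF p assms(1)])
  finally have "l2norm p * l2norm p \<le> l2norm p * l2norm f"
    by (simp add: power2_eq_square)
  then have "l2norm p \<le> l2norm f"
    using l2norm_nonneg[of p] l2norm_nonneg[of f] by (cases "l2norm p = 0") (auto simp: mult_le_cancel_left)
  then show ?thesis
    unfolding eq[symmetric] by (intro power_mono) auto
qed

subsection \<open>Uniqueness of Fourier coefficients\<close>

text \<open>On the circle cnj z = z^(-1), so Re z and Im z are combinations of z and z^(-1).
  Multiplying by a real linear form therefore only shifts frequencies by one; this is the base case
  for real polynomials.\<close>

lemma bounded_linear_circle:
  assumes "bounded_linear (p :: complex \<Rightarrow> real)"
  obtains a where "\<And>z. cmod z = 1 \<Longrightarrow> of_real (p z) = a * z powi 1 + cnj a * z powi (- 1)"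
proof
  interpret bounded_linear p by fact
  fix z :: complex assume z: "cmod z = 1"
  have "p z = p (Re z *\<^sub>R 1 + Im z *\<^sub>R \<i>)"
    by (rule arg_cong[where f = p]) (simp add: complex_eq_iff)
  then have "p z = Re z * p 1 + Im z * p \<i>"
    by (simp only: add scaleR real_scaleR_def)
  moreover have "z powi (- 1) = cnj z"
    using cnj_powi_circle[OF z, of 1] by simp
  ultimately show "of_real (p z) =
      Complex (p 1 / 2) (- p \<i> / 2) * z powi 1 + cnj (Complex (p 1 / 2) (- p \<i> / 2)) * z powi (- 1)"
    by (simp add: complex_eq_iff)
qed

text \<open>
  The induction runs over all \<open>f\<close> at once, so that the product of polynomials needs no
  Fourier expansion.
\<close>

lemma fourier_polynomial_mult:
  assumes "real_polynomial_function (p :: complex \<Rightarrow> real)" "f \<in> L2" "\<And>k. fourier f k = 0"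
  shows "(\<lambda>z. of_real (p z) * f z) \<in> L2 \<and> (\<forall>k. fourier (\<lambda>z. of_real (p z) * f z) k = 0)"
  using assms
proof (induction p arbitrary: f rule: real_polynomial_function.induct)
  case (linear p)
  then obtain a where a: "\<And>z. cmod z = 1 \<Longrightarrow> of_real (p z) = a * z powi 1 + cnj a * z powi (- 1)"
    using bounded_linear_circle by blast
  define g where "g = (\<lambda>z. a * (z powi 1 * f z) + cnj a * (z powi (- 1) * f z))"
  have g: "g \<in> L2"
    unfolding g_def by (intro L2_add L2_scale L2_powi_mult linear)
  have ae: "AE z in circ. of_real (p z) * f z = g z"
    using AE_circ_norm by eventually_elim (simp only: a g_def ring_distribs mult.assoc)
  have "continuous_on (sphere 0 1) p"
    using linear(1) by (simp add: linear_continuous_on)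
  then have "(\<lambda>z. complex_of_real (p z)) \<in> borel_measurable circ"
    by (intro borel_measurable_circ_continuous continuous_intros)
  then have meas: "(\<lambda>z. of_real (p z) * f z) \<in> borel_measurable circ"
    using linear(2) by measurable
  have "fourier g k = 0" for k
    unfolding g_def using linear
    by (subst fourier_add) (simp_all only: L2_scale L2_powi_mult fourier_scale fourier_powi_mult mult_zero_right add_0)
  then show ?case
    using L2_cong_AE[OF meas g ae] fourier_cong_AE[OF meas L2_measurable[OF g] ae] by simp
next
  case (const c)
  then show ?case by (simp add: L2_scale fourier_scale)
next
  case (add p q)
  then show ?case by (simp add: ring_distribs L2_add fourier_add)
next
  case (mult p q)
  have "(\<lambda>z. of_real (p z) * (of_real (q z) * f z)) \<in> L2 \<and>
      (\<forall>k. fourier (\<lambda>z. of_real (p z) * (of_real (q z) * f z)) k = 0)"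
    using mult.IH(2)[OF mult.prems] by (intro mult.IH(1)) auto
  then show ?case by (simp add: mult.assoc)
qed

text \<open>By Stone-Weierstrass \<open>\<phi>\<close> is uniformly close to a polynomial
  \<open>p\<close>. The integral of p f is the zeroth coefficient of p f, hence 0, and the error is
  at most e times the L^1 norm of \<open>f\<close>.\<close>

lemma integral_continuous_mult_eq_0:
  assumes f: "f \<in> L2" "\<And>k. fourier f k = 0" and \<phi>: "continuous_on (sphere 0 1) (\<phi> :: complex \<Rightarrow> real)"
  shows "(LINT z|circ. of_real (\<phi> z) * f z) = 0"
proof -
  define I where "I = (LINT z|circ. cmod (f z))"
  have "I \<ge> 0" unfolding I_def by simp
  have "cmod (LINT z|circ. of_real (\<phi> z) * f z) \<le> e * I" if e: "e > 0" for e
  proof -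
    obtain p where p: "real_polynomial_function p" "\<And>z. z \<in> sphere 0 1 \<Longrightarrow> \<bar>\<phi> z - p z\<bar> < e"
      using Stone_Weierstrass_real_polynomial_function[OF compact_sphere \<phi> e] by blast
    have pf: "(\<lambda>z. of_real (p z) * f z) \<in> L2" "fourier (\<lambda>z. of_real (p z) * f z) 0 = 0"
      using fourier_polynomial_mult[OF p(1) f] by auto
    have "continuous_on (sphere 0 1) p"
      using p(1) continuous_on_polymonial_function real_polynomial_function_eq by blast
    then have m: "(\<lambda>z. complex_of_real (\<phi> z - p z)) \<in> borel_measurable circ"
      by (intro borel_measurable_circ_continuous continuous_intros \<phi>)
    have d: "(\<lambda>z. of_real (\<phi> z - p z) * f z) \<in> L2"
      by (rule L2_bounded_mult[where C = e]) (use m f p(2) in \<open>auto intro!: AE_I2 less_imp_le simp del: of_real_diff\<close>)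
    have "(LINT z|circ. of_real (\<phi> z) * f z) =
        (LINT z|circ. of_real (\<phi> z - p z) * f z + of_real (p z) * f z)"
      by (simp add: ring_distribs)
    also have "\<dots> = (LINT z|circ. of_real (\<phi> z - p z) * f z)"
      using pf(2) by (subst Bochner_Integration.integral_add)
        (auto intro!: integrable_L2 pf d simp: fourier_eq simp del: of_real_diff)
    also have "cmod \<dots> \<le> (LINT z|circ. cmod (of_real (\<phi> z - p z) * f z))"
      by (rule integral_norm_bound)
    also have "\<dots> \<le> (LINT z|circ. e * cmod (f z))"
    proof (rule integral_mono)
      show "cmod (of_real (\<phi> z - p z) * f z) \<le> e * cmod (f z)" if "z \<in> space circ" for z
        using p(2)[of z] that unfolding norm_mult norm_of_real by (intro mult_right_mono) auto
    qed (intro integrable_norm integrable_mult_right integrable_L2 d f)+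
    finally show ?thesis by (simp add: I_def)
  qed
  then have "cmod (LINT z|circ. of_real (\<phi> z) * f z) \<le> 0 + e" if "e > 0" for e
  proof -
    \<comment> \<open>The denominator is \<open>I + 1\<close> because \<open>I\<close> may
      vanish.\<close>
    have "cmod (LINT z|circ. of_real (\<phi> z) * f z) \<le> e / (I + 1) * I"
      using that \<open>I \<ge> 0\<close> \<open>\<And>e. e > 0 \<Longrightarrow> _ \<le> e * I\<close>[of "e / (I + 1)"] by simp
    also have "\<dots> \<le> e" using that \<open>I \<ge> 0\<close> by (simp add: field_simps)
    finally show ?thesis by simp
  qed
  then have "cmod (LINT z|circ. of_real (\<phi> z) * f z) \<le> 0"
    by (rule field_le_epsilon)
  then show ?thesis by simp
qed

text \<open>The indicator of a closed set is a pointwise limit of continuous cut-offs in the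
  distance to the set; |f| dominates.\<close>

lemma integral_indicator_closed_eq_0:
  assumes f: "f \<in> L2" "\<And>k. fourier f k = 0" and A: "closed A"
  shows "(LINT z|circ. of_real (indicator A z) * f z) = 0"
\<comment> \<open>\<open>infdist\<close> to the empty set is 0 by convention, so the cut-offs would
  be constantly 1 there.\<close>
proof (cases "A = {}")
  case False
  define \<phi> where "\<phi> n z = max 0 (1 - real n * infdist z A)" for n z
  have cont: "continuous_on (sphere 0 1) (\<phi> n)" for n
    unfolding \<phi>_def by (intro continuous_intros)
  have bound: "0 \<le> \<phi> n z" "\<phi> n z \<le> 1" for n z
    by (auto simp: \<phi>_def infdist_nonneg)
  have lim: "(\<lambda>n. \<phi> n z) \<longlonglongrightarrow> indicator A z" for z
  proof (cases "z \<in> A")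
    case True
    then show ?thesis by (simp add: \<phi>_def)
  next
    case out: False
    then have pos: "infdist z A > 0"
      using A False by (meson infdist_nonneg infdist_pos_not_in_closed)
    obtain N where N: "real N * infdist z A > 1"
      using reals_Archimedean3[OF pos] by blast
    have "\<phi> n z = 0" if "n \<ge> N" for n
    proof -
      have "real N * infdist z A \<le> real n * infdist z A"
        using that pos by simp
      with N show ?thesis by (simp add: \<phi>_def)
    qed
    then have "eventually (\<lambda>n. \<phi> n z = 0) sequentially"
      unfolding eventually_sequentially by blast
    then show ?thesis using out by (simp add: tendsto_eventually)
  qed
  have mA: "(indicator A :: complex \<Rightarrow> real) \<in> borel_measurable circ"
  proof -
    have "(indicator A :: complex \<Rightarrow> real) \<in> borel_measurable borel"
      using A by (intro borel_measurable_indicator borel_closed)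
    then show ?thesis
      unfolding borel_measurable_circ by (rule measurable_restrict_space1)
  qed
  have "(\<lambda>n. LINT z|circ. of_real (\<phi> n z) * f z) \<longlonglongrightarrow> (LINT z|circ. of_real (indicator A z) * f z)"
  proof (rule integral_dominated_convergence[where w = "\<lambda>z. cmod (f z)"])
    show "(\<lambda>z. of_real (\<phi> n z) * f z) \<in> borel_measurable circ" for n
      using borel_measurable_circ_continuous[OF cont[of n]] L2_measurable[OF f(1)] by measurable
    show "(\<lambda>z. of_real (indicator A z) * f z) \<in> borel_measurable circ"
      using mA L2_measurable[OF f(1)] by measurable
    show "AE z in circ. cmod (of_real (\<phi> n z) * f z) \<le> cmod (f z)" for n
      using bound[of n] by (auto simp: norm_mult mult_left_le_one_le)
  qed (auto intro!: integrable_norm integrable_L2 f AE_I2 tendsto_intros lim)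
  moreover have "(LINT z|circ. of_real (\<phi> n z) * f z) = 0" for n
    by (rule integral_continuous_mult_eq_0[OF f cont])
  ultimately show ?thesis
    by (simp add: LIMSEQ_const_iff)
qed simp

text \<open>Dynkin argument: the closed sets generate the Borel sets and are stable under
  intersection, and the sets over which \<open>f\<close> integrates to 0 are stable under
  complements and disjoint countable unions.\<close>

lemma integral_indicator_borel_eq_0:
  assumes f: "f \<in> L2" "\<And>k. fourier f k = 0" and B: "B \<in> sets borel"
  shows "(LINT z|circ. of_real (indicator B z) * f z) = 0"
proof -
  note [measurable] = L2_measurable[OF f(1)]
  have ind: "(indicator B :: complex \<Rightarrow> real) \<in> borel_measurable circ" if "B \<in> sets borel" for B
    unfolding borel_measurable_circ using that by (intro measurable_restrict_space1) simp
  have int: "integrable circ (\<lambda>z. of_real (indicator B z) * f z)" if "B \<in> sets borel" for B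
    by (intro integrable_L2 L2_bounded_mult[where C = 1] f AE_I2)
       (use ind[OF that] in \<open>auto split: split_indicator\<close>)
  have borel: "sets borel = sigma_sets UNIV (Collect closed :: complex set set)"
    by (subst borel_eq_closed) simp
  have "Int_stable (Collect closed :: complex set set)"
    by (auto simp: Int_stable_def)
  moreover have "Collect closed \<subseteq> Pow (UNIV :: complex set)"
    by simp
  moreover have "B \<in> sigma_sets UNIV (Collect closed)"
    using B borel by simp
  ultimately show ?thesis
  proof (induction B rule: sigma_sets_induct_disjoint)
    case (basic A)
    then show ?case using integral_indicator_closed_eq_0[OF f] by simp
  next
    case (compl A)
    have "(LINT z|circ. of_real (indicator (UNIV - A) z) * f z) =
        (LINT z|circ. of_real (indicator UNIV z) * f z - of_real (indicator A z) * f z)"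
      by (intro Bochner_Integration.integral_cong) (auto split: split_indicator)
    also have "\<dots> = 0"
      using compl integral_indicator_closed_eq_0[OF f closed_UNIV]
      by (subst Bochner_Integration.integral_diff[OF int int]) (simp_all add: borel)
    finally show ?case .
  next
    case (union A)
    have sets: "A i \<in> sets borel" for i
      using union(2) borel by auto
    have "(\<lambda>n. LINT z|circ. of_real (indicator (\<Union>i<n. A i) z) * f z) \<longlonglongrightarrow>
        (LINT z|circ. of_real (indicator (\<Union>i. A i) z) * f z)"
    proof (rule integral_dominated_convergence[where w = "\<lambda>z. cmod (f z)"])
      show "AE z in circ. (\<lambda>n. of_real (indicator (\<Union>i<n. A i) z) * f z) \<longlonglongrightarrow>
          of_real (indicator (\<Union>i. A i) z) * f z"
        by (intro AE_I2 tendsto_intros LIMSEQ_indicator_UN)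
    qed (auto intro!: integrable_norm integrable_L2 f AE_I2 borel_measurable_integrable int sets
           split: split_indicator)
    moreover have "(LINT z|circ. of_real (indicator (\<Union>i<n. A i) z) * f z) = 0" for n
    proof (induction n)
      case (Suc n)
      have "(LINT z|circ. of_real (indicator (\<Union>i<Suc n. A i) z) * f z) =
          (LINT z|circ. of_real (indicator (\<Union>i<n. A i) z) * f z + of_real (indicator (A n) z) * f z)"
      proof (intro Bochner_Integration.integral_cong refl)
        fix z
        have "z \<notin> A n" if "i < n" "z \<in> A i" for i
          using disjoint_family_onD[OF union(1), of i n] that by auto
        then show "of_real (indicator (\<Union>i<Suc n. A i) z) * f z =
            of_real (indicator (\<Union>i<n. A i) z) * f z + of_real (indicator (A n) z) * f z"
          by (auto simp: less_Suc_eq split: split_indicator)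
      qed
      also have "\<dots> = 0"
        using Suc union(3)[of n]
        by (subst Bochner_Integration.integral_add[OF int int]) (auto intro!: sets)
      finally show ?case .
    qed simp
    ultimately show ?case
      by (simp add: LIMSEQ_const_iff)
  qed auto
qed

text \<open>The integral of \<open>f\<close> over every measurable set vanishes. Uniqueness of
  densities is applied to real functions, with \<open>T\<close> standing for \<open>Re\<close> and
  for \<open>Im\<close>.\<close>

theorem fourier_eq_0_imp_AE:
  assumes f: "f \<in> L2" "\<And>k. fourier f k = 0"
  shows "AE z in circ. f z = 0"
proof -
  note [measurable] = L2_measurable[OF f(1)]
  have zero: "AE z in circ. T (f z) = (0::real)" if T: "bounded_linear T" for T
  proof (rule density_unique_real)
    interpret bounded_linear T by fact
    show "integrable circ (\<lambda>z. T (f z))"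
      by (intro integrable_bounded_linear[OF T] integrable_L2 f)
    fix A assume "A \<in> sets circ"
    then obtain B where B: "B \<in> sets borel" "A = sphere 0 1 \<inter> B"
      by (auto simp: sets_circ sets_restrict_space)
    have "(LINT z:A|circ. T (f z)) = (LINT z|circ. T (of_real (indicator B z) * f z))"
      unfolding set_lebesgue_integral_def
      by (intro Bochner_Integration.integral_cong) (auto simp: B scaleR[symmetric] scaleR_conv_of_real zero split: split_indicator)
    also have "\<dots> = T (LINT z|circ. of_real (indicator B z) * f z)"
      by (rule integral_bounded_linear[OF T])
         (intro integrable_L2 L2_bounded_mult[where C = 1] f AE_I2,
          use B in \<open>auto simp: borel_measurable_circ intro!: measurable_restrict_space1 split: split_indicator\<close>)
    also have "\<dots> = 0"
      using integral_indicator_borel_eq_0[OF f B(1)] zero by simp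
    finally show "(LINT z:A|circ. T (f z)) = (LINT z:A|circ. 0)"
      by (simp add: set_lebesgue_integral_def)
  qed simp
  from zero[OF bounded_linear_Re] zero[OF bounded_linear_Im] show ?thesis
    by eventually_elim (simp add: complex_eq_iff)
qed

lemma fourier_unique:
  assumes "f \<in> L2" "g \<in> L2" "\<And>k. fourier f k = fourier g k"
  shows "AE z in circ. f z = g z"
  using fourier_eq_0_imp_AE[OF L2_diff[OF assms(1,2)]] assms by (simp add: fourier_diff)

subsection \<open>Completeness of \<open>L\<^sup>2\<close> and the Hardy space\<close>

text \<open>Sum and nonnegative integral may be exchanged, so the sum of the norms has a finite
  integral and is finite AE.\<close>

lemma AE_summable_norm:
  fixes d :: "nat \<Rightarrow> 'a \<Rightarrow> 'b::real_normed_vector"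
  assumes [measurable]: "\<And>n. (\<lambda>x. norm (d n x)) \<in> borel_measurable M"
    and int: "\<And>n. integrable M (\<lambda>x. norm (d n x))"
    and sum: "summable (\<lambda>n. LINT x|M. norm (d n x))"
  shows "AE x in M. summable (\<lambda>n. norm (d n x))"
proof -
  have "(\<integral>\<^sup>+x. (\<Sum>n. ennreal (norm (d n x))) \<partial>M) = (\<Sum>n. \<integral>\<^sup>+x. ennreal (norm (d n x)) \<partial>M)"
    by (rule nn_integral_suminf) measurable
  also have "\<dots> = (\<Sum>n. ennreal (LINT x|M. norm (d n x)))"
    by (intro suminf_cong nn_integral_eq_integral int) simp
  also have "\<dots> = ennreal (\<Sum>n. LINT x|M. norm (d n x))"
    by (rule suminf_ennreal2[OF _ sum]) simp
  finally have "(\<integral>\<^sup>+x. (\<Sum>n. ennreal (norm (d n x))) \<partial>M) \<noteq> \<infinity>"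
    by simp
  then have "AE x in M. (\<Sum>n. ennreal (norm (d n x))) \<noteq> \<infinity>"
    by (intro nn_integral_PInf_AE) measurable
  then show ?thesis
    by eventually_elim (intro summable_suminf_not_top, auto simp: infinity_ennreal_def)
qed

lemma l2norm_fast_Cauchy:
  assumes L2: "\<And>n. f n \<in> L2" and fast: "\<And>n. l2norm (\<lambda>z. f (Suc n) z - f n z) \<le> (1 / 2) ^ n"
    and "n \<le> m"
  shows "l2norm (\<lambda>z. f m z - f n z) \<le> 2 * (1 / 2) ^ n"
proof -
  \<comment> \<open>The bound is strengthened by the tail of the geometric series, which makes it
    inductive in \<open>m\<close>.\<close>
  have "l2norm (\<lambda>z. f m z - f n z) \<le> 2 * (1 / 2) ^ n - 2 * (1 / 2) ^ m"
    using \<open>n \<le> m\<close>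
  proof (induction m rule: dec_induct)
    case base
    show ?case by (simp add: l2norm_def)
  next
    case (step m)
    have "l2norm (\<lambda>z. (f (Suc m) z - f m z) + (f m z - f n z)) \<le>
        l2norm (\<lambda>z. f (Suc m) z - f m z) + l2norm (\<lambda>z. f m z - f n z)"
      by (intro l2norm_triangle L2_diff L2)
    with fast[of m] step.IH show ?case by simp
  qed
  also have "\<dots> \<le> 2 * (1 / 2) ^ n" by simp
  finally show ?thesis .
qed

text \<open>The geometric rate makes the increments summable in L^1, so the sequence itself
  converges AE, without a subsequence, and Fatou's lemma carries the Cauchy bound over to the
  limit.\<close>

lemma L2_complete_fast:
  assumes L2: "\<And>n. f n \<in> L2" and fast: "\<And>n. l2norm (\<lambda>z. f (Suc n) z - f n z) \<le> (1 / 2) ^ n"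
  obtains g where "g \<in> L2" "(\<lambda>n. l2norm (\<lambda>z. f n z - g z)) \<longlonglongrightarrow> 0"
proof -
  note [measurable] = L2_measurable[OF L2]
  define d where "d n z = f (Suc n) z - f n z" for n z
  have d: "d n \<in> L2" for n
    unfolding d_def by (intro L2_diff L2)
  note [measurable] = L2_measurable[OF d]
  \<comment> \<open>Cauchy-Schwarz against the constant 1, written as \<open>z powi 0\<close>, whose
    norm is 1.\<close>
  have d_le: "(LINT z|circ. cmod (d n z)) \<le> (1 / 2) ^ n" for n
    using integral_norm_le_l2norm[OF d L2_powi[of 0], of n] fast[of n] l2norm_powi[of 0]
    by (simp add: d_def[abs_def])
  have "AE z in circ. summable (\<lambda>n. cmod (d n z))"
  proof (rule AE_summable_norm)
    show "summable (\<lambda>n. LINT z|circ. cmod (d n z))"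
      by (rule summable_comparison_test'[where g = "\<lambda>n. (1 / 2) ^ n" and N = 0])
         (use d_le in \<open>auto intro: summable_geometric\<close>)
  qed (auto intro!: integrable_norm integrable_L2 d)
  then have conv: "AE z in circ. convergent (\<lambda>n. f n z)"
  proof eventually_elim
    case (elim z)
    have "(\<Sum>i<n. d i z) = f n z - f 0 z" for n
      unfolding d_def by (rule sum_lessThan_telescope)
    then have "(\<lambda>n. f n z) = (\<lambda>n. (\<Sum>i<n. d i z) + f 0 z)"
      by auto
    moreover have "convergent (\<lambda>n. \<Sum>i<n. d i z)"
      using summable_norm_cancel[OF elim] by (simp add: summable_iff_convergent)
    ultimately show ?case
      by (metis convergent_add_const_right_iff)
  qed
  define g where "g z = lim (\<lambda>n. f n z)" for z
  have [measurable]: "g \<in> borel_measurable circ"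
    unfolding g_def by (rule borel_measurable_lim_metric) measurable
  \<comment> \<open>Fatou's lemma is stated for the nonnegative integral, since
    \<open>f n - g\<close> is not yet known to be in \<open>L2\<close>; its membership is drawn from
    this bound.\<close>
  have bound: "(\<integral>\<^sup>+z. ennreal ((cmod (f n z - g z))\<^sup>2) \<partial>circ) \<le> ennreal ((2 * (1 / 2) ^ n)\<^sup>2)" for n
  proof -
    have "(\<integral>\<^sup>+z. ennreal ((cmod (f n z - g z))\<^sup>2) \<partial>circ) =
        (\<integral>\<^sup>+z. liminf (\<lambda>m. ennreal ((cmod (f n z - f m z))\<^sup>2)) \<partial>circ)"
    proof (intro nn_integral_cong_AE)
      show "AE z in circ. ennreal ((cmod (f n z - g z))\<^sup>2) = liminf (\<lambda>m. ennreal ((cmod (f n z - f m z))\<^sup>2))"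
        using conv
      proof eventually_elim
        case (elim z)
        then have "(\<lambda>m. ennreal ((cmod (f n z - f m z))\<^sup>2)) \<longlonglongrightarrow> ennreal ((cmod (f n z - g z))\<^sup>2)"
          unfolding g_def convergent_LIMSEQ_iff by (intro tendsto_intros)
        from lim_imp_Liminf[OF _ this] show ?case by simp
      qed
    qed
    also have "\<dots> \<le> liminf (\<lambda>m. \<integral>\<^sup>+z. ennreal ((cmod (f n z - f m z))\<^sup>2) \<partial>circ)"
      by (rule nn_integral_liminf) measurable
    also have "\<dots> \<le> ennreal ((2 * (1 / 2) ^ n)\<^sup>2)"
    proof (rule Liminf_le)
      show "\<forall>\<^sub>F m in sequentially. (\<integral>\<^sup>+z. ennreal ((cmod (f n z - f m z))\<^sup>2) \<partial>circ) \<le> ennreal ((2 * (1 / 2) ^ n)\<^sup>2)"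
        using eventually_ge_at_top[of n]
      proof eventually_elim
        case (elim m)
        have "(\<integral>\<^sup>+z. ennreal ((cmod (f n z - f m z))\<^sup>2) \<partial>circ) = ennreal ((l2norm (\<lambda>z. f n z - f m z))\<^sup>2)"
          unfolding l2norm_power2
          by (intro nn_integral_eq_integral L2_integrable L2_diff L2) simp
        also have "\<dots> \<le> ennreal ((2 * (1 / 2) ^ n)\<^sup>2)"
          using l2norm_fast_Cauchy[OF L2 fast elim] l2norm_minus[of "f n" "f m"]
          by (intro ennreal_leI power_mono) auto
        finally show ?case .
      qed
    qed simp
    finally show ?thesis .
  qed
  have fg: "(\<lambda>z. f n z - g z) \<in> L2" for n
  proof -
    have "integrable circ (\<lambda>z. (cmod (f n z - g z))\<^sup>2)"
    proof (rule integrableI_bounded)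
      show "(\<integral>\<^sup>+z. ennreal (norm ((cmod (f n z - g z))\<^sup>2)) \<partial>circ) < \<infinity>"
        using le_less_trans[OF bound ennreal_less_top] by (simp add: infinity_ennreal_def)
    qed measurable
    then show ?thesis by (simp add: L2_def)
  qed
  have "g \<in> L2"
    using L2_diff[OF L2[of 0] fg[of 0]] by simp
  have le: "l2norm (\<lambda>z. f n z - g z) \<le> 2 * (1 / 2) ^ n" for n
  proof -
    have "ennreal ((l2norm (\<lambda>z. f n z - g z))\<^sup>2) \<le> ennreal ((2 * (1 / 2) ^ n)\<^sup>2)"
      unfolding l2norm_power2 using bound[of n]
      by (subst nn_integral_eq_integral[symmetric]) (auto intro!: L2_integrable fg)
    then have "(l2norm (\<lambda>z. f n z - g z))\<^sup>2 \<le> (2 * (1 / 2) ^ n)\<^sup>2"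
      by (subst (asm) ennreal_le_iff) auto
    then show ?thesis by (rule power2_le_imp_le) simp
  qed
  have "(\<lambda>n. 2 * (1 / 2) ^ n :: real) \<longlonglongrightarrow> 0"
    by (intro tendsto_mult_right_zero LIMSEQ_power_zero) simp
  then have "(\<lambda>n. l2norm (\<lambda>z. f n z - g z)) \<longlonglongrightarrow> 0"
    by (rule Lim_null_comparison[rotated]) (use le in auto)
  with \<open>g \<in> L2\<close> show ?thesis by (rule that)
qed

lemma ip_tendsto:
  assumes "\<And>n. f n \<in> L2" "g \<in> L2" "h \<in> L2" "(\<lambda>n. l2norm (\<lambda>z. f n z - g z)) \<longlonglongrightarrow> 0"
  shows "(\<lambda>n. ip (f n) h) \<longlonglongrightarrow> ip g h"
proof -
  have "(\<lambda>n. ip (f n) h - ip g h) \<longlonglongrightarrow> 0"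
  proof (rule Lim_null_comparison)
    show "\<forall>\<^sub>F n in sequentially. norm (ip (f n) h - ip g h) \<le> l2norm (\<lambda>z. f n z - g z) * l2norm h"
      using norm_ip_le[OF L2_diff[OF assms(1,2)] assms(3)] assms(1-3)
      by (intro always_eventually allI) (simp add: ip_diff_left)
    show "(\<lambda>n. l2norm (\<lambda>z. f n z - g z) * l2norm h) \<longlonglongrightarrow> 0"
      by (intro tendsto_mult_left_zero assms)
  qed
  then show ?thesis by (simp add: LIM_zero_iff)
qed

definition nonneg_trig :: "(int \<Rightarrow> complex) \<Rightarrow> nat \<Rightarrow> complex \<Rightarrow> complex" where
  "nonneg_trig c n z = (\<Sum>k\<in>{0..<int n}. c k * z powi k)"

lemma nonneg_trig_L2: "nonneg_trig c n \<in> L2"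
  unfolding nonneg_trig_def[abs_def] by (rule L2_trig)

text \<open>Only nonnegative frequencies are summed, so that the limit automatically lies in the
  Hardy space. Convergence along some subsequence \<open>N\<close> of partial sums is enough: it
  identifies all coefficients of \<open>g\<close> and gives density of trigonometric
  polynomials.\<close>

lemma riesz_fischer:
  assumes bound: "\<And>n. (\<Sum>k\<in>{0..<int n}. (cmod (c k))\<^sup>2) \<le> C"
  obtains g N where "g \<in> L2" "\<And>k. fourier g k = (if k \<ge> 0 then c k else 0)"
    "(\<lambda>j. l2norm (\<lambda>z. nonneg_trig c (N j) z - g z)) \<longlonglongrightarrow> 0"
proof -
  define a where "a i = (cmod (c (int i)))\<^sup>2" for i
  have a_sum: "(\<Sum>i<n. a i) = (\<Sum>k\<in>{0..<int n}. (cmod (c k))\<^sup>2)" for n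
    unfolding a_def by (rule sum.reindex_bij_witness[of _ nat int]) auto
  have "summable a"
  proof (rule bounded_imp_summable)
    show "(\<Sum>i\<le>n. a i) \<le> C" for n
      using bound[of "Suc n"] a_sum[of "Suc n"] by (simp add: lessThan_Suc_atMost)
  qed (simp add: a_def)
  \<comment> \<open>\<open>a\<close> consists of squares, so 1/4 here becomes the rate 1/2 for the
    norms that \<open>L2_complete_fast\<close> requires.\<close>
  then have "\<exists>N. \<forall>m\<ge>N. \<forall>n. norm (sum a {m..<n}) < (1 / 4) ^ j" for j :: nat
    unfolding summable_Cauchy by simp
  then obtain N0 where N0: "\<And>j m n. m \<ge> N0 j \<Longrightarrow> norm (sum a {m..<n}) < (1 / 4) ^ j"
    by metis
  \<comment> \<open>The chosen \<open>N0\<close> need be neither monotone nor unbounded; summing it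
    gives the first, adding \<open>j\<close> the second, so that every frequency is eventually
    included.\<close>
  define N where "N j = (\<Sum>i\<le>j. N0 i) + j" for j
  have N: "N j \<ge> N0 j" "N j \<ge> j" "N j \<le> N (Suc j)" for j
    unfolding N_def by (auto intro: trans_le_add1 member_le_sum)
  have fast: "l2norm (\<lambda>z. nonneg_trig c (N (Suc j)) z - nonneg_trig c (N j) z) \<le> (1 / 2) ^ j" for j
  proof -
    have "nonneg_trig c (N (Suc j)) z - nonneg_trig c (N j) z =
        (\<Sum>k\<in>{int (N j)..<int (N (Suc j))}. c k * z powi k)" for z
    proof -
      have "{0..<int (N (Suc j))} = {0..<int (N j)} \<union> {int (N j)..<int (N (Suc j))}"
        using N(3)[of j] by auto
      then show ?thesis
        unfolding nonneg_trig_def by (simp add: sum.union_disjoint[of "{0..<int (N j)}"])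
    qed
    then have "(l2norm (\<lambda>z. nonneg_trig c (N (Suc j)) z - nonneg_trig c (N j) z))\<^sup>2 =
        (\<Sum>k\<in>{int (N j)..<int (N (Suc j))}. (cmod (c k))\<^sup>2)"
      by (simp add: l2norm_trig)
    also have "\<dots> = sum a {N j..<N (Suc j)}"
      unfolding a_def by (rule sum.reindex_bij_witness[of _ int nat]) auto
    also have "\<dots> \<le> (1 / 4) ^ j"
      using N0[OF N(1), of j "N (Suc j)"] by simp
    also have "\<dots> = ((1 / 2) ^ j)\<^sup>2"
      by (simp add: power2_eq_square power_mult_distrib[symmetric])
    finally show ?thesis by (rule power2_le_imp_le) simp
  qed
  obtain g where g: "g \<in> L2" "(\<lambda>j. l2norm (\<lambda>z. nonneg_trig c (N j) z - g z)) \<longlonglongrightarrow> 0"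
    using L2_complete_fast[OF nonneg_trig_L2 fast] by blast
  have "fourier g k = (if k \<ge> 0 then c k else 0)" for k
  proof (rule LIMSEQ_unique)
    show "(\<lambda>j. fourier (nonneg_trig c (N j)) k) \<longlonglongrightarrow> fourier g k"
      unfolding fourier_def by (intro ip_tendsto nonneg_trig_L2 g L2_powi)
    have "\<forall>\<^sub>F j in sequentially. fourier (nonneg_trig c (N j)) k = (if k \<ge> 0 then c k else 0)"
      using eventually_gt_at_top[of "nat k"]
    proof eventually_elim
      case (elim j)
      with N(2)[of j] have "k < int (N j)" by linarith
      then show ?case
        unfolding nonneg_trig_def[abs_def] by (simp add: fourier_trig)
    qed
    then show "(\<lambda>j. fourier (nonneg_trig c (N j)) k) \<longlonglongrightarrow> (if k \<ge> 0 then c k else 0)"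
      by (rule tendsto_eventually)
  qed
  with g show ?thesis by (intro that)
qed

section \<open>The Hardy space and the Szego projector\<close>

lemma L2_plusD: "f \<in> L2_plus \<Longrightarrow> f \<in> L2" "f \<in> L2_plus \<Longrightarrow> k < 0 \<Longrightarrow> fourier f k = 0"
  by (auto simp: plus_part_def)

lemma L2_plusI: "f \<in> L2 \<Longrightarrow> (\<And>k. k < 0 \<Longrightarrow> fourier f k = 0) \<Longrightarrow> f \<in> L2_plus"
  by (auto simp: plus_part_def)

lemma L2_plus_add: "f \<in> L2_plus \<Longrightarrow> g \<in> L2_plus \<Longrightarrow> (\<lambda>z. f z + g z) \<in> L2_plus"
  by (intro L2_plusI) (auto simp: L2_plusD L2_add fourier_add)

lemma L2_plus_diff: "f \<in> L2_plus \<Longrightarrow> g \<in> L2_plus \<Longrightarrow> (\<lambda>z. f z - g z) \<in> L2_plus"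
  by (intro L2_plusI) (auto simp: L2_plusD L2_diff fourier_diff)

lemma L2_plus_scale: "f \<in> L2_plus \<Longrightarrow> (\<lambda>z. c * f z) \<in> L2_plus"
  by (intro L2_plusI) (auto simp: L2_plusD L2_scale fourier_scale)

lemma L2_plus_powi: "k \<ge> 0 \<Longrightarrow> (\<lambda>z. z powi k) \<in> L2_plus"
  by (intro L2_plusI L2_powi) (auto simp: fourier_powi)

lemma bessel_nonneg:
  "f \<in> L2 \<Longrightarrow> (\<Sum>k\<in>{0..<int n}. (cmod (fourier f k))\<^sup>2) \<le> (l2norm f)\<^sup>2"
  by (rule bessel) auto

text \<open>Up to AE, \<open>h\<close> is an L^2 limit of trigonometric polynomials with frequencies
  k >= 0, and each of these is orthogonal to \<open>f\<close>.\<close>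

lemma ip_L2_plus_eq_0:
  assumes h: "h \<in> L2_plus" and f: "f \<in> L2" "\<And>k. k \<ge> 0 \<Longrightarrow> fourier f k = 0"
  shows "ip f h = 0"
proof -
  note hL2 = L2_plusD(1)[OF h]
  obtain g N where g: "g \<in> L2" "\<And>k. fourier g k = (if k \<ge> 0 then fourier h k else 0)"
    and lim: "(\<lambda>j. l2norm (\<lambda>z. nonneg_trig (fourier h) (N j) z - g z)) \<longlonglongrightarrow> 0"
    using riesz_fischer[OF bessel_nonneg[OF hL2]] by blast
  have "(\<lambda>j. ip (nonneg_trig (fourier h) (N j)) f) \<longlonglongrightarrow> ip g f"
    by (intro ip_tendsto nonneg_trig_L2 g f lim)
  moreover have "ip (nonneg_trig (fourier h) n) f = 0" for n
    unfolding nonneg_trig_def[abs_def] using f by (simp add: ip_trig)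
  ultimately have "ip g f = 0" by (simp add: LIMSEQ_const_iff)
  moreover have "AE z in circ. g z = h z"
    using g h by (intro fourier_unique) (auto simp: L2_plusD)
  then have "ip g f = ip h f"
    using g(1) hL2 f(1) by (intro ip_cong_AE) (auto simp: L2_measurable)
  ultimately show ?thesis by (simp add: ip_commute[of f])
qed

text \<open>The choice defining \<open>szego_proj\<close> is not vacuous: Riesz-Fischer supplies a
  function with the nonnegative coefficients of \<open>f\<close>, and the remainder has only
  negative frequencies.\<close>

lemma szego_proj:
  assumes f: "f \<in> L2"
  shows szego_proj_L2_plus: "szego_proj f \<in> L2_plus"
    and ip_szego_proj: "h \<in> L2_plus \<Longrightarrow> ip (szego_proj f) h = ip f h"
proof -
  obtain g N where g: "g \<in> L2" "\<And>k. fourier g k = (if k \<ge> 0 then fourier f k else 0)"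
    using riesz_fischer[OF bessel_nonneg[OF f]] by metis
  have "g \<in> L2_plus" by (intro L2_plusI) (auto simp: g)
  moreover have "\<forall>h\<in>L2_plus. ip (\<lambda>z. f z - g z) h = 0"
    by (intro ballI ip_L2_plus_eq_0) (auto simp: L2_diff fourier_diff f g)
  ultimately have *: "szego_proj f \<in> L2_plus \<and> (\<forall>h\<in>L2_plus. ip (\<lambda>z. f z - szego_proj f z) h = 0)"
    unfolding szego_proj_def by (rule someI[of _ g, OF conjI])
  then show "szego_proj f \<in> L2_plus" by simp
  assume h: "h \<in> L2_plus"
  with * show "ip (szego_proj f) h = ip f h"
    using ip_diff_left[OF f L2_plusD(1) L2_plusD(1)[OF h], of "szego_proj f"] by simp
qed

lemma fourier_szego_proj: "f \<in> L2 \<Longrightarrow> fourier (szego_proj f) k = (if k \<ge> 0 then fourier f k else 0)"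
  using szego_proj_L2_plus[of f] ip_szego_proj[OF _ L2_plus_powi, of f k]
  by (auto simp: L2_plusD fourier_def[symmetric])

lemma L2_plus_eqI:
  assumes "f \<in> L2_plus" "g \<in> L2_plus" "\<And>k. k \<ge> 0 \<Longrightarrow> fourier f k = fourier g k"
  shows "AE z in circ. f z = g z"
proof (rule fourier_unique)
  show "fourier f k = fourier g k" for k
    using assms by (cases "k \<ge> 0") (auto simp: L2_plusD)
qed (use assms in \<open>auto simp: L2_plusD\<close>)

lemma szego_proj_ident: "f \<in> L2_plus \<Longrightarrow> AE z in circ. szego_proj f z = f z"
  by (rule L2_plus_eqI) (auto simp: L2_plusD szego_proj_L2_plus fourier_szego_proj)

text \<open>As the projection P of \<open>f\<close> is itself in \<open>L2_plus\<close>, (P|P) =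
  (f|P), and Cauchy-Schwarz applies.\<close>

lemma l2norm_szego_proj_le:
  assumes f: "f \<in> L2"
  shows "l2norm (szego_proj f) \<le> l2norm f"
proof -
  note P = szego_proj_L2_plus[OF f]
  have "of_real ((l2norm (szego_proj f))\<^sup>2) = ip f (szego_proj f)"
    unfolding ip_self[symmetric] by (rule ip_szego_proj[OF f P])
  then have "(l2norm (szego_proj f))\<^sup>2 = cmod (ip f (szego_proj f))"
    by (metis abs_of_nonneg norm_of_real zero_le_power2)
  also have "\<dots> \<le> l2norm f * l2norm (szego_proj f)"
    by (rule norm_ip_le[OF f L2_plusD(1)[OF P]])
  finally have "l2norm (szego_proj f) * l2norm (szego_proj f) \<le> l2norm f * l2norm (szego_proj f)"
    by (simp add: power2_eq_square)
  then show ?thesis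
    using l2norm_nonneg[of "szego_proj f"] l2norm_nonneg[of f]
    by (cases "l2norm (szego_proj f) = 0") (auto simp: mult_le_cancel_right)
qed

subsection \<open>Absolutely convergent Fourier series\<close>

definition sym_trig :: "(int \<Rightarrow> complex) \<Rightarrow> nat \<Rightarrow> complex \<Rightarrow> complex" where
  "sym_trig c n z = (\<Sum>k\<in>{- int n..int n}. c k * z powi k)"

lemma sym_trig_L2: "sym_trig c n \<in> L2"
  unfolding sym_trig_def[abs_def] by (rule L2_trig)

text \<open>\<open>summable_on\<close> refers to the net of all finite sets; the symmetric intervals
  are cofinal in it, so that sums over the integers can be evaluated along a sequence.\<close>

lemma filterlim_sym_interval:
  "filterlim (\<lambda>n. {- int n..int n}) (finite_subsets_at_top UNIV) sequentially"
  unfolding filterlim_finite_subsets_at_top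
proof (intro allI impI)
  fix X :: "int set" assume X: "finite X \<and> X \<subseteq> UNIV"
  then have "finite ((\<lambda>x. nat \<bar>x\<bar>) ` X)" by simp
  then obtain m where m: "\<And>x. x \<in> X \<Longrightarrow> nat \<bar>x\<bar> \<le> m"
    unfolding finite_nat_set_iff_bounded_le by auto
  show "\<forall>\<^sub>F n in sequentially. finite {- int n..int n} \<and> X \<subseteq> {- int n..int n} \<and> {- int n..int n} \<subseteq> UNIV"
    using eventually_ge_at_top[of m]
  proof eventually_elim
    case (elim n)
    have "x \<in> {- int n..int n}" if "x \<in> X" for x
      using m[OF that] elim by auto
    then show ?case by auto
  qed
qed

lemma infsum_compl_sym_tendsto:
  fixes a :: "int \<Rightarrow> real"
  assumes "a summable_on UNIV"
  shows "(\<lambda>n. infsum a (- {- int n..int n})) \<longlonglongrightarrow> 0"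
proof -
  have "(sum a \<longlongrightarrow> infsum a UNIV) (finite_subsets_at_top UNIV)"
    using has_sum_infsum[OF assms] by (simp add: has_sum_def)
  from filterlim_compose[OF this filterlim_sym_interval]
  have "(\<lambda>n. infsum a UNIV - sum a {- int n..int n}) \<longlonglongrightarrow> infsum a UNIV - infsum a UNIV"
    by (intro tendsto_intros)
  moreover have "infsum a UNIV - sum a {- int n..int n} = infsum a (- {- int n..int n})" for n
  proof -
    have "infsum a ({- int n..int n} \<union> - {- int n..int n}) =
        infsum a {- int n..int n} + infsum a (- {- int n..int n})"
      by (intro infsum_Un_disjoint summable_on_subset_banach[OF assms]) auto
    then show ?thesis by simp
  qed
  ultimately show ?thesis by simp
qed

text \<open>The Wiener algebra of absolutely convergent Fourier series. It serves as the hypothesis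
  on symbols, between H^s with s > 1/2 and the essentially bounded functions.\<close>

definition wiener :: "(complex \<Rightarrow> complex) set" where
  "wiener = {f \<in> L2. (\<lambda>k. cmod (fourier f k)) summable_on UNIV}"

definition wiener_tail :: "(complex \<Rightarrow> complex) \<Rightarrow> nat \<Rightarrow> real" where
  "wiener_tail f n = (\<Sum>\<^sub>\<infinity>k\<in>- {- int n..int n}. cmod (fourier f k))"

lemma wienerD:
  assumes "f \<in> wiener"
  shows wiener_L2: "f \<in> L2"
    and wiener_summable: "(\<lambda>k. cmod (fourier f k)) summable_on A"
  using assms summable_on_subset_banach by (auto simp: wiener_def)

lemma wiener_tail_tendsto: "f \<in> wiener \<Longrightarrow> wiener_tail f \<longlonglongrightarrow> 0"
  unfolding wiener_tail_def[abs_def] by (intro infsum_compl_sym_tendsto wiener_summable)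

text \<open>The series converges uniformly on the circle to a function \<open>g\<close> with the
  coefficients of \<open>f\<close>, so \<open>f\<close> and \<open>g\<close> agree AE. One null set
  serves all \<open>n\<close>.\<close>

lemma wiener_series:
  assumes f: "f \<in> wiener"
  shows wiener_approx: "AE z in circ. \<forall>n. cmod (f z - sym_trig (fourier f) n z) \<le> wiener_tail f n"
    and wiener_bounded: "AE z in circ. cmod (f z) \<le> (\<Sum>\<^sub>\<infinity>k. cmod (fourier f k))"
proof -
  define S where "S = sym_trig (fourier f)"
  define g where "g z = (\<Sum>\<^sub>\<infinity>k. fourier f k * z powi k)" for z
  define C where "C = (\<Sum>\<^sub>\<infinity>k. cmod (fourier f k))"
  have abs: "(\<lambda>k. norm (fourier f k * z powi k)) summable_on A" if "cmod z = 1" for z A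
    using wiener_summable[OF f] that by (simp add: norm_mult norm_power_int)
  have tail: "cmod (g z - S n z) \<le> wiener_tail f n" if z: "cmod z = 1" for z n
  proof -
    have "g z = (\<Sum>\<^sub>\<infinity>k\<in>{- int n..int n} \<union> - {- int n..int n}. fourier f k * z powi k)"
      by (simp add: g_def)
    also have "\<dots> = S n z + (\<Sum>\<^sub>\<infinity>k\<in>- {- int n..int n}. fourier f k * z powi k)"
      unfolding S_def sym_trig_def
      by (subst infsum_Un_disjoint) (auto intro!: abs_summable_summable[OF abs[OF z]])
    finally have "cmod (g z - S n z) = cmod (\<Sum>\<^sub>\<infinity>k\<in>- {- int n..int n}. fourier f k * z powi k)"
      by simp
    also have "\<dots> \<le> (\<Sum>\<^sub>\<infinity>k\<in>- {- int n..int n}. cmod (fourier f k * z powi k))"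
      by (rule norm_infsum_bound[OF abs[OF z]])
    also have "\<dots> = wiener_tail f n"
      using z by (simp add: wiener_tail_def norm_mult norm_power_int)
    finally show ?thesis .
  qed
  have bound: "cmod (g z) \<le> C" if z: "cmod z = 1" for z
    using norm_infsum_bound[OF abs[OF z], of UNIV] z
    by (simp add: g_def C_def norm_mult norm_power_int)
  have lim: "(\<lambda>n. S n z) \<longlonglongrightarrow> g z" if z: "cmod z = 1" for z
  proof -
    have "(\<lambda>n. g z - S n z) \<longlonglongrightarrow> 0"
      using tail[OF z] by (intro Lim_null_comparison[OF _ wiener_tail_tendsto[OF f]]) auto
    from tendsto_diff[OF tendsto_const[of "g z"] this] show ?thesis by simp
  qed
  have gm: "g \<in> borel_measurable circ"
    by (rule borel_measurable_LIMSEQ_metric[where f = S])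
       (auto simp: S_def sym_trig_L2 L2_measurable intro: lim[unfolded S_def])
  have g: "g \<in> L2"
    by (rule L2_I_bound[where g = "\<lambda>_. C\<^sup>2"]) (auto intro!: gm AE_I2 power_mono bound)
  have "fourier f k = fourier g k" for k
  proof (rule LIMSEQ_unique)
    show "(\<lambda>n. fourier (S n) k) \<longlonglongrightarrow> fourier g k"
    proof (rule LIM_zero_cancel, rule Lim_null_comparison[OF _ wiener_tail_tendsto[OF f]], intro always_eventually allI)
      fix n
      have "cmod (fourier (S n) k - fourier g k) = cmod (fourier (\<lambda>z. g z - S n z) k)"
        by (simp add: fourier_diff g S_def sym_trig_L2 norm_minus_commute)
      also have "\<dots> \<le> l2norm (\<lambda>z. g z - S n z)"
        by (intro norm_fourier_le L2_diff g) (simp add: S_def sym_trig_L2)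
      also have "\<dots> \<le> wiener_tail f n * l2norm (\<lambda>z. z powi 0)"
      proof (rule l2norm_mono_bound)
        show "(\<lambda>z. g z - S n z) \<in> borel_measurable circ"
          by (intro L2_measurable L2_diff g) (simp add: S_def sym_trig_L2)
        show "AE z in circ. cmod (g z - S n z) \<le> wiener_tail f n * cmod (z powi 0)"
          using AE_circ_norm by eventually_elim (simp add: tail)
        show "wiener_tail f n \<ge> 0"
          unfolding wiener_tail_def by (rule infsum_nonneg) simp
      qed (rule L2_powi)
      finally show "cmod (fourier (S n) k - fourier g k) \<le> wiener_tail f n"
        by (simp only: l2norm_powi mult_1_right)
    qed
    have "\<forall>\<^sub>F n in sequentially. fourier (S n) k = fourier f k"
      using eventually_ge_at_top[of "nat \<bar>k\<bar>"]
    proof eventually_elim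
      case (elim n)
      then have "k \<in> {- int n..int n}" by auto
      then show ?case
        unfolding S_def sym_trig_def[abs_def] by (simp add: fourier_trig)
    qed
    then show "(\<lambda>n. fourier (S n) k) \<longlonglongrightarrow> fourier f k"
      by (rule tendsto_eventually)
  qed
  then have "AE z in circ. f z = g z"
    using wiener_L2[OF f] g by (intro fourier_unique) auto
  with AE_circ_norm have ae: "AE z in circ. cmod z = 1 \<and> f z = g z"
    by eventually_elim simp
  show "AE z in circ. \<forall>n. cmod (f z - sym_trig (fourier f) n z) \<le> wiener_tail f n"
    using ae by eventually_elim (auto simp: tail[unfolded S_def])
  show "AE z in circ. cmod (f z) \<le> (\<Sum>\<^sub>\<infinity>k. cmod (fourier f k))"
    using ae by eventually_elim (auto simp: bound[unfolded C_def])
qed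

lemma L2_wiener_mult: "f \<in> wiener \<Longrightarrow> g \<in> L2 \<Longrightarrow> (\<lambda>z. f z * g z) \<in> L2"
  by (rule L2_bounded_mult[OF _ _ wiener_bounded]) (auto intro: L2_measurable wiener_L2)

text \<open>Trigonometric polynomials approximate \<open>f\<close> uniformly, hence their products
  with \<open>g\<close> approximate f g in L^2, and multiplying by z^j shifts coefficients. Absolute
  convergence is asked of one factor only.\<close>

lemma fourier_wiener_mult:
  assumes f: "f \<in> wiener" and g: "g \<in> L2"
  shows "(\<lambda>n. \<Sum>j\<in>{- int n..int n}. fourier f j * fourier g (k - j)) \<longlonglongrightarrow> fourier (\<lambda>z. f z * g z) k"
proof -
  have "(\<lambda>n. fourier (\<lambda>z. sym_trig (fourier f) n z * g z) k) \<longlonglongrightarrow> fourier (\<lambda>z. f z * g z) k"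
  proof (rule LIM_zero_cancel, rule Lim_null_comparison)
    have S: "(\<lambda>z. sym_trig (fourier f) n z * g z) \<in> L2" for n
      unfolding sym_trig_def sum_distrib_right mult.assoc by (intro L2_sum L2_scale L2_powi_mult g)
    show "\<forall>\<^sub>F n in sequentially. norm (fourier (\<lambda>z. sym_trig (fourier f) n z * g z) k - fourier (\<lambda>z. f z * g z) k)
        \<le> wiener_tail f n * l2norm g"
    proof (intro always_eventually allI)
      fix n
      have "norm (fourier (\<lambda>z. sym_trig (fourier f) n z * g z) k - fourier (\<lambda>z. f z * g z) k) =
          cmod (fourier (\<lambda>z. sym_trig (fourier f) n z * g z - f z * g z) k)"
        by (simp add: fourier_diff S L2_wiener_mult f g)
      also have "\<dots> \<le> l2norm (\<lambda>z. sym_trig (fourier f) n z * g z - f z * g z)"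
        by (intro norm_fourier_le L2_diff S L2_wiener_mult f g)
      also have "\<dots> \<le> wiener_tail f n * l2norm g"
      proof (rule l2norm_mono_bound)
        show "(\<lambda>z. sym_trig (fourier f) n z * g z - f z * g z) \<in> borel_measurable circ"
          by (intro L2_measurable L2_diff S L2_wiener_mult f g)
        show "AE z in circ. cmod (sym_trig (fourier f) n z * g z - f z * g z) \<le> wiener_tail f n * cmod (g z)"
          using wiener_approx[OF f]
          by eventually_elim
             (auto simp: left_diff_distrib[symmetric] norm_mult norm_minus_commute intro!: mult_right_mono)
        show "wiener_tail f n \<ge> 0"
          unfolding wiener_tail_def by (rule infsum_nonneg) simp
      qed (rule g)
      finally show "norm (fourier (\<lambda>z. sym_trig (fourier f) n z * g z) k - fourier (\<lambda>z. f z * g z) k)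
        \<le> wiener_tail f n * l2norm g" .
    qed
    show "(\<lambda>n. wiener_tail f n * l2norm g) \<longlonglongrightarrow> 0"
      by (intro tendsto_mult_left_zero wiener_tail_tendsto f)
  qed
  moreover have "fourier (\<lambda>z. sym_trig (fourier f) n z * g z) k =
      (\<Sum>j\<in>{- int n..int n}. fourier f j * fourier g (k - j))" for n
  proof -
    have "fourier (\<lambda>z. \<Sum>j\<in>{- int n..int n}. fourier f j * (z powi j * g z)) k =
        (\<Sum>j\<in>{- int n..int n}. fourier (\<lambda>z. fourier f j * (z powi j * g z)) k)"
      unfolding fourier_def[of _ k] by (intro ip_sum_left L2_scale L2_powi_mult L2_powi g)
    then show ?thesis
      by (simp add: sym_trig_def sum_distrib_right mult.assoc fourier_scale fourier_powi_mult)
  qed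
  ultimately show ?thesis by simp
qed

text \<open>For k < 0, every term of the convolution has j < 0 or k - j < 0, so one of its factors
  vanishes.\<close>

lemma L2_plus_wiener_mult:
  assumes f: "f \<in> wiener" "f \<in> L2_plus" and g: "g \<in> L2_plus"
  shows "(\<lambda>z. f z * g z) \<in> L2_plus"
proof (rule L2_plusI)
  show "(\<lambda>z. f z * g z) \<in> L2"
    by (intro L2_wiener_mult f L2_plusD(1)[OF g])
  fix k :: int assume "k < 0"
  have zero: "fourier f j * fourier g (k - j) = 0" for j
    using L2_plusD(2)[OF f(2), of j] L2_plusD(2)[OF g, of "k - j"] \<open>k < 0\<close> by (cases "j < 0") auto
  then show "fourier (\<lambda>z. f z * g z) k = 0"
    using fourier_wiener_mult[OF f(1) L2_plusD(1)[OF g], of k]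
    unfolding zero by (simp add: LIMSEQ_const_iff)
qed

subsection \<open>Sobolev spaces\<close>

definition weight :: "real \<Rightarrow> int \<Rightarrow> real" where
  "weight s k = (1 + (real_of_int k)\<^sup>2) powr s"

lemma weight_pos [simp]: "weight s k > 0"
proof -
  have "1 + (real_of_int k)\<^sup>2 > 0" by (simp add: add_pos_nonneg)
  then show ?thesis by (simp add: weight_def)
qed

lemma weight_nonneg [simp]: "weight s k \<ge> 0"
  by (simp add: weight_def)

lemma weight_uminus [simp]: "weight s (- k) = weight s k"
  by (simp add: weight_def)

text \<open>If |j| <= |k|, then (j + k)^2 <= 2 j^2 + 2 k^2 <= 4 k^2, whence the factor 4. The sum on
  the right majorises the larger of the two weights.\<close>

lemma weight_add_le:
  assumes "s > 0"
  shows "weight s (j + k) \<le> 4 powr s * (weight s j + weight s k)"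
proof -
  have *: "weight s (j + k) \<le> 4 powr s * weight s k" if "\<bar>j\<bar> \<le> \<bar>k\<bar>" for j k
  proof -
    have "(real_of_int j)\<^sup>2 \<le> (real_of_int k)\<^sup>2"
      using that by (simp add: abs_le_square_iff[symmetric])
    moreover have "2 * real_of_int j * real_of_int k \<le> (real_of_int j)\<^sup>2 + (real_of_int k)\<^sup>2"
      by (rule sum_squares_bound)
    ultimately have "1 + (real_of_int (j + k))\<^sup>2 \<le> 4 * (1 + (real_of_int k)\<^sup>2)"
      by (simp add: power2_sum)
    then have "weight s (j + k) \<le> (4 * (1 + (real_of_int k)\<^sup>2)) powr s"
      unfolding weight_def using assms by (intro powr_mono2) auto
    also have "\<dots> = 4 powr s * weight s k"
      unfolding weight_def by (rule powr_mult)
    finally show ?thesis .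
  qed
  show ?thesis
  proof (cases "\<bar>j\<bar> \<le> \<bar>k\<bar>")
    case True
    from *[OF this] show ?thesis
      by (simp add: ring_distribs add_increasing)
  next
    case False
    then have "weight s (k + j) \<le> 4 powr s * weight s j"
      by (intro *) simp
    then show ?thesis
      by (simp add: ring_distribs add.commute add_increasing2)
  qed
qed

text \<open>Comparison with the series of n^(-2 s), which converges exactly for s > 1/2; the
  negative frequencies are a reflected copy.\<close>

lemma summable_inverse_weight:
  assumes "s > 1 / 2"
  shows "(\<lambda>k. 1 / weight s k) summable_on UNIV"
proof -
  have nat: "(\<lambda>n. 1 / weight s (int n)) summable_on UNIV"
  proof -
    have "summable (\<lambda>n. real n powr (- 2 * s))"
      using assms by (subst summable_real_powr_iff) simp
    then have "summable (\<lambda>n. 1 / weight s (int n))"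
    \<comment> \<open>At n = 0 the majorant is \<open>0 powr (- 2 * s) = 0\<close>, whereas the term
      is 1, so the comparison starts at 1.\<close>
    proof (rule summable_comparison_test'[where N = 1])
      fix n :: nat assume n: "1 \<le> n"
      have "real n powr (2 * s) = ((real n)\<^sup>2) powr s"
        using n by (simp add: powr_powr[symmetric])
      also have "\<dots> \<le> weight s (int n)"
        unfolding weight_def using assms by (intro powr_mono2) auto
      finally have "1 / weight s (int n) \<le> 1 / real n powr (2 * s)"
        using n by (intro divide_left_mono) auto
      then show "norm (1 / weight s (int n)) \<le> real n powr (- 2 * s)"
        by (simp add: powr_minus_divide)
    qed
    then show ?thesis
      by (subst summable_on_UNIV_nonneg_real_iff) auto
  qed
  have "(\<lambda>k. 1 / weight s k) summable_on (range int \<union> range (\<lambda>n. - int n))"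
    using nat by (intro summable_on_union; subst summable_on_reindex) (auto simp: inj_on_def comp_def)
  moreover have "range int \<union> range (\<lambda>n. - int n) = UNIV"
  proof (intro equalityI subsetI)
    fix k :: int
    show "k \<in> range int \<union> range (\<lambda>n. - int n)"
      by (cases k rule: int_cases2) auto
  qed simp
  ultimately show ?thesis by simp
qed

lemma hs_norm_nonneg [simp]: "hs_norm s f \<ge> 0"
  unfolding hs_norm_def by (intro real_sqrt_ge_zero infsum_nonneg) auto

lemma HsD:
  assumes "f \<in> Hs s"
  shows Hs_L2: "f \<in> L2"
    and Hs_sum_le: "finite K \<Longrightarrow> (\<Sum>k\<in>K. weight s k * (cmod (fourier f k))\<^sup>2) \<le> (hs_norm s f)\<^sup>2"
proof -
  show "f \<in> L2" using assms by (simp add: Hs_def)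
  assume "finite K"
  have "(hs_norm s f)\<^sup>2 = (\<Sum>\<^sub>\<infinity>k. weight s k * (cmod (fourier f k))\<^sup>2)"
    unfolding hs_norm_def weight_def by (intro real_sqrt_pow2 infsum_nonneg) auto
  also have "(\<Sum>k\<in>K. weight s k * (cmod (fourier f k))\<^sup>2) \<le> \<dots>"
    using assms \<open>finite K\<close> by (intro finite_sum_le_infsum) (auto simp: Hs_def weight_def)
  finally show "(\<Sum>k\<in>K. weight s k * (cmod (fourier f k))\<^sup>2) \<le> (hs_norm s f)\<^sup>2" .
qed

text \<open>A bound on finite partial sums yields summability and the norm estimate together, so
  that the default value 0 of a divergent infinite sum in \<open>hs_norm\<close> cannot
  interfere.\<close>

lemma HsI:
  assumes "f \<in> L2" "C \<ge> 0"
    and le: "\<And>K. finite K \<Longrightarrow> (\<Sum>k\<in>K. weight s k * (cmod (fourier f k))\<^sup>2) \<le> C\<^sup>2"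
  shows "f \<in> Hs s \<and> hs_norm s f \<le> C"
proof -
  have sum: "(\<lambda>k. weight s k * (cmod (fourier f k))\<^sup>2) summable_on UNIV"
    by (rule nonneg_bdd_above_summable_on) (auto intro!: bdd_aboveI2 le)
  have "hs_norm s f \<le> sqrt (C\<^sup>2)"
    unfolding hs_norm_def weight_def[symmetric]
    by (intro real_sqrt_le_mono infsum_le_finite_sums[OF sum]) (use le in auto)
  with sum assms show ?thesis by (simp add: Hs_def weight_def)
qed

text \<open>The constant 2 comes from |a + b|^2 <= 2 |a|^2 + 2 |b|^2. The sharp triangle inequality
  is dispensable, since such bounds only serve to show that norms tend to 0.\<close>

lemma Hs_add:
  assumes f: "f \<in> Hs s" and g: "g \<in> Hs s"
  shows "(\<lambda>z. f z + g z) \<in> Hs s \<and> hs_norm s (\<lambda>z. f z + g z) \<le> 2 * (hs_norm s f + hs_norm s g)"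
proof (rule HsI)
  show "(\<lambda>z. f z + g z) \<in> L2" by (intro L2_add Hs_L2[OF f] Hs_L2[OF g])
  fix K :: "int set" assume K: "finite K"
  have "weight s k * (cmod (fourier (\<lambda>z. f z + g z) k))\<^sup>2 \<le>
      2 * (weight s k * (cmod (fourier f k))\<^sup>2) + 2 * (weight s k * (cmod (fourier g k))\<^sup>2)" for k
  proof -
    have "(cmod (fourier (\<lambda>z. f z + g z) k))\<^sup>2 \<le> (cmod (fourier f k) + cmod (fourier g k))\<^sup>2"
      using Hs_L2[OF f] Hs_L2[OF g] by (intro power_mono) (auto simp: fourier_add norm_triangle_ineq)
    also have "\<dots> \<le> 2 * (cmod (fourier f k))\<^sup>2 + 2 * (cmod (fourier g k))\<^sup>2"
      using sum_squares_bound[of "cmod (fourier f k)" "cmod (fourier g k)"] by (simp add: power2_sum)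
    finally have "weight s k * (cmod (fourier (\<lambda>z. f z + g z) k))\<^sup>2 \<le>
        weight s k * (2 * (cmod (fourier f k))\<^sup>2 + 2 * (cmod (fourier g k))\<^sup>2)"
      by (intro mult_left_mono) auto
    then show ?thesis by (simp add: algebra_simps)
  qed
  then have "(\<Sum>k\<in>K. weight s k * (cmod (fourier (\<lambda>z. f z + g z) k))\<^sup>2) \<le>
      2 * (\<Sum>k\<in>K. weight s k * (cmod (fourier f k))\<^sup>2) + 2 * (\<Sum>k\<in>K. weight s k * (cmod (fourier g k))\<^sup>2)"
    unfolding sum_distrib_left sum.distrib[symmetric] by (intro sum_mono)
  also have "\<dots> \<le> 2 * (hs_norm s f)\<^sup>2 + 2 * (hs_norm s g)\<^sup>2"
    using Hs_sum_le[OF f K] Hs_sum_le[OF g K] by simp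
  also have "\<dots> \<le> (2 * (hs_norm s f + hs_norm s g))\<^sup>2"
    using mult_nonneg_nonneg[OF hs_norm_nonneg hs_norm_nonneg, of s f s g]
    by (simp add: power_mult_distrib power2_sum)
  finally show "(\<Sum>k\<in>K. weight s k * (cmod (fourier (\<lambda>z. f z + g z) k))\<^sup>2) \<le> (2 * (hs_norm s f + hs_norm s g))\<^sup>2" .
qed simp

lemma Hs_scale:
  assumes f: "f \<in> Hs s"
  shows "(\<lambda>z. c * f z) \<in> Hs s \<and> hs_norm s (\<lambda>z. c * f z) \<le> cmod c * hs_norm s f"
proof (rule HsI)
  fix K :: "int set" assume K: "finite K"
  have "(\<Sum>k\<in>K. weight s k * (cmod (fourier (\<lambda>z. c * f z) k))\<^sup>2) =
      (cmod c)\<^sup>2 * (\<Sum>k\<in>K. weight s k * (cmod (fourier f k))\<^sup>2)"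
    by (simp add: fourier_scale norm_mult power_mult_distrib sum_distrib_left mult_ac)
  also have "\<dots> \<le> (cmod c)\<^sup>2 * (hs_norm s f)\<^sup>2"
    by (intro mult_left_mono Hs_sum_le f K) simp
  finally show "(\<Sum>k\<in>K. weight s k * (cmod (fourier (\<lambda>z. c * f z) k))\<^sup>2) \<le> (cmod c * hs_norm s f)\<^sup>2"
    by (simp add: power_mult_distrib)
qed (auto intro: L2_scale Hs_L2 f)

lemma Hs_diff: "f \<in> Hs s \<Longrightarrow> g \<in> Hs s \<Longrightarrow> (\<lambda>z. f z - g z) \<in> Hs s"
  using Hs_add[of f s "\<lambda>z. - 1 * g z"] Hs_scale[of g s "- 1"] by simp

lemma Hs_cnj:
  assumes f: "f \<in> Hs s"
  shows "(\<lambda>z. cnj (f z)) \<in> Hs s \<and> hs_norm s (\<lambda>z. cnj (f z)) \<le> hs_norm s f"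
proof (rule HsI)
  fix K :: "int set" assume K: "finite K"
  have "(\<Sum>k\<in>K. weight s k * (cmod (fourier (\<lambda>z. cnj (f z)) k))\<^sup>2) =
      (\<Sum>k\<in>uminus ` K. weight s k * (cmod (fourier f k))\<^sup>2)"
    by (subst sum.reindex) (auto simp: fourier_cnj)
  also have "\<dots> \<le> (hs_norm s f)\<^sup>2"
    using K by (intro Hs_sum_le f) simp
  finally show "(\<Sum>k\<in>K. weight s k * (cmod (fourier (\<lambda>z. cnj (f z)) k))\<^sup>2) \<le> (hs_norm s f)\<^sup>2" .
qed (auto intro: L2_cnj Hs_L2 f)

lemma Hs_szego_proj:
  assumes f: "f \<in> Hs s"
  shows "szego_proj f \<in> Hs_plus s \<and> hs_norm s (szego_proj f) \<le> hs_norm s f"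
proof -
  note P = szego_proj_L2_plus[OF Hs_L2[OF f]]
  have "szego_proj f \<in> Hs s \<and> hs_norm s (szego_proj f) \<le> hs_norm s f"
  proof (rule HsI)
    fix K :: "int set" assume K: "finite K"
    have "(\<Sum>k\<in>K. weight s k * (cmod (fourier (szego_proj f) k))\<^sup>2) \<le>
        (\<Sum>k\<in>K. weight s k * (cmod (fourier f k))\<^sup>2)"
      by (intro sum_mono) (auto simp: fourier_szego_proj Hs_L2[OF f])
    also have "\<dots> \<le> (hs_norm s f)\<^sup>2" by (rule Hs_sum_le[OF f K])
    finally show "(\<Sum>k\<in>K. weight s k * (cmod (fourier (szego_proj f) k))\<^sup>2) \<le> (hs_norm s f)\<^sup>2" .
  qed (use P in \<open>auto simp: L2_plusD\<close>)
  with P show ?thesis by (simp add: plus_part_def)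
qed

section \<open>Sobolev embedding and the algebra property of H^s\<close>

definition sobolev_const :: "real \<Rightarrow> real" where
  "sobolev_const s = (\<Sum>\<^sub>\<infinity>k. 1 / weight s k)"

lemma sobolev_const_nonneg [simp]: "sobolev_const s \<ge> 0"
  unfolding sobolev_const_def by (rule infsum_nonneg) simp

lemma sum_inverse_weight_le:
  assumes "s > 1 / 2" "finite K"
  shows "(\<Sum>k\<in>K. 1 / weight s k) \<le> sobolev_const s"
  unfolding sobolev_const_def
  by (intro finite_sum_le_infsum summable_inverse_weight assms) auto

text \<open>Cauchy-Schwarz after splitting each coefficient into
  \<open>sqrt (1 / weight s k)\<close> and \<open>sqrt (weight s k)\<close> times the
  coefficient.\<close>

lemma Hs_wiener:
  assumes s: "s > 1 / 2" and f: "f \<in> Hs s"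
  shows "f \<in> wiener \<and> (\<Sum>\<^sub>\<infinity>k. cmod (fourier f k)) \<le> sqrt (sobolev_const s) * hs_norm s f"
proof -
  have le: "(\<Sum>k\<in>K. cmod (fourier f k)) \<le> sqrt (sobolev_const s) * hs_norm s f" if K: "finite K" for K
  proof -
    have "(\<Sum>k\<in>K. cmod (fourier f k))\<^sup>2 =
        (\<Sum>k\<in>K. sqrt (1 / weight s k) * (sqrt (weight s k) * cmod (fourier f k)))\<^sup>2"
      by (simp add: real_sqrt_divide less_imp_neq[symmetric])
    also have "\<dots> \<le> (\<Sum>k\<in>K. (sqrt (1 / weight s k))\<^sup>2) * (\<Sum>k\<in>K. (sqrt (weight s k) * cmod (fourier f k))\<^sup>2)"
      by (rule Cauchy_Schwarz_ineq_sum)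
    also have "\<dots> = (\<Sum>k\<in>K. 1 / weight s k) * (\<Sum>k\<in>K. weight s k * (cmod (fourier f k))\<^sup>2)"
      by (simp add: power_mult_distrib)
    also have "\<dots> \<le> sobolev_const s * (hs_norm s f)\<^sup>2"
      by (intro mult_mono sum_inverse_weight_le s K Hs_sum_le f) (auto intro: sum_nonneg)
    also have "\<dots> = (sqrt (sobolev_const s) * hs_norm s f)\<^sup>2"
      by (simp add: power_mult_distrib)
    finally show ?thesis by (rule power2_le_imp_le) simp
  qed
  have sum: "(\<lambda>k. cmod (fourier f k)) summable_on UNIV"
    by (rule nonneg_bdd_above_summable_on) (auto intro!: bdd_aboveI2 le)
  then show ?thesis
    using Hs_L2[OF f] infsum_le_finite_sums[OF sum le] by (simp add: wiener_def)
qed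

lemma Hs_bounded:
  assumes s: "s > 1 / 2" and f: "f \<in> Hs s"
  shows "AE z in circ. cmod (f z) \<le> sqrt (sobolev_const s) * hs_norm s f"
  using wiener_bounded[of f] Hs_wiener[OF s f] by (auto elim!: eventually_mono)

text \<open>\<open>4 powr s\<close> is the constant of \<open>weight_add_le\<close>; the factor 2
  counts the two reciprocal weights it leaves in the convolution estimate, each summing to at most
  \<open>sobolev_const s\<close>.\<close>

definition algebra_const :: "real \<Rightarrow> real" where
  "algebra_const s = 2 * 4 powr s * sobolev_const s"

lemma algebra_const_nonneg [simp]: "algebra_const s \<ge> 0"
  by (simp add: algebra_const_def)

text \<open>
  A single Cauchy--Schwarz inequality suffices, since
  \<open>weight k / (weight j * weight (k - j))\<close> is summable in \<open>j\<close>, uniformly in \<open>k\<close>.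
\<close>

lemma weighted_convolution_le:
  fixes a b :: "int \<Rightarrow> complex"
  assumes s: "s > 1 / 2" and J: "finite J"
  shows "weight s k * (cmod (\<Sum>j\<in>J. a j * b (k - j)))\<^sup>2 \<le>
    algebra_const s * (\<Sum>j\<in>J. (weight s j * (cmod (a j))\<^sup>2) * (weight s (k - j) * (cmod (b (k - j)))\<^sup>2))"
proof -
  define w where "w j = weight s j * weight s (k - j)" for j
  have w: "w j > 0" for j by (simp add: w_def)
  have "(cmod (\<Sum>j\<in>J. a j * b (k - j)))\<^sup>2 \<le> (\<Sum>j\<in>J. cmod (a j * b (k - j)))\<^sup>2"
    by (intro power_mono norm_sum) simp
  also have "\<dots> = (\<Sum>j\<in>J. sqrt (1 / w j) * (sqrt (w j) * cmod (a j * b (k - j))))\<^sup>2"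
    using w by (simp add: real_sqrt_divide less_imp_neq[symmetric])
  also have "\<dots> \<le> (\<Sum>j\<in>J. (sqrt (1 / w j))\<^sup>2) * (\<Sum>j\<in>J. (sqrt (w j) * cmod (a j * b (k - j)))\<^sup>2)"
    by (rule Cauchy_Schwarz_ineq_sum)
  also have "\<dots> = (\<Sum>j\<in>J. 1 / w j) * (\<Sum>j\<in>J. w j * (cmod (a j * b (k - j)))\<^sup>2)"
    using w by (simp add: power_mult_distrib less_imp_le)
  finally have "weight s k * (cmod (\<Sum>j\<in>J. a j * b (k - j)))\<^sup>2 \<le>
      (\<Sum>j\<in>J. weight s k / w j) * (\<Sum>j\<in>J. w j * (cmod (a j * b (k - j)))\<^sup>2)"
    using mult_left_mono[OF _ weight_nonneg[of s k]]
    by (simp add: sum_distrib_left[of "weight s k" "\<lambda>j. 1 / w j", simplified, symmetric] mult.assoc)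
  also have "\<dots> \<le> algebra_const s * (\<Sum>j\<in>J. w j * (cmod (a j * b (k - j)))\<^sup>2)"
  proof (intro mult_right_mono)
    have "weight s k / w j \<le> 4 powr s * (1 / weight s (k - j) + 1 / weight s j)" for j
    proof -
      have "weight s k / w j \<le> 4 powr s * (weight s j + weight s (k - j)) / w j"
        using weight_add_le[of s j "k - j"] s w[of j] by (intro divide_right_mono) auto
      also have "\<dots> = 4 powr s * (1 / weight s (k - j) + 1 / weight s j)"
        using weight_pos[of s j] weight_pos[of s "k - j"]
        unfolding w_def by (simp add: field_simps del: weight_pos)
      finally show ?thesis .
    qed
    then have "(\<Sum>j\<in>J. weight s k / w j) \<le> (\<Sum>j\<in>J. 4 powr s * (1 / weight s (k - j) + 1 / weight s j))"
      by (rule sum_mono)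
    also have "\<dots> = 4 powr s * ((\<Sum>j\<in>J. 1 / weight s (k - j)) + (\<Sum>j\<in>J. 1 / weight s j))"
      by (simp only: sum_distrib_left[symmetric] sum.distrib)
    also have "(\<Sum>j\<in>J. 1 / weight s (k - j)) = (\<Sum>i\<in>(\<lambda>j. k - j) ` J. 1 / weight s i)"
      by (subst sum.reindex) (auto simp: inj_on_def)
    also have "4 powr s * ((\<Sum>i\<in>(\<lambda>j. k - j) ` J. 1 / weight s i) + (\<Sum>j\<in>J. 1 / weight s j)) \<le>
        4 powr s * (sobolev_const s + sobolev_const s)"
      by (intro mult_left_mono add_mono sum_inverse_weight_le s) (auto simp: J)
    finally show "(\<Sum>j\<in>J. weight s k / w j) \<le> algebra_const s"
      by (simp add: algebra_const_def)
    show "0 \<le> (\<Sum>j\<in>J. w j * (cmod (a j * b (k - j)))\<^sup>2)"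
      using w by (intro sum_nonneg mult_nonneg_nonneg) (auto simp: less_imp_le)
  qed
  finally show ?thesis
    by (simp add: w_def norm_mult power_mult_distrib mult_ac)
qed

text \<open>For a convolution truncated to |j| <= n, the sum over \<open>k\<close> is taken first:
  it meets only a translate of \<open>K\<close>, so the part of \<open>g\<close> is bounded by its
  norm uniformly in \<open>j\<close>. The truncation is then removed by n tending to infinity, with
  \<open>K\<close> still finite.\<close>

lemma Hs_mult:
  assumes s: "s > 1 / 2" and f: "f \<in> Hs s" and g: "g \<in> Hs s"
  shows "(\<lambda>z. f z * g z) \<in> Hs s \<and>
    hs_norm s (\<lambda>z. f z * g z) \<le> sqrt (algebra_const s) * (hs_norm s f * hs_norm s g)"
proof (rule HsI)
  have fw: "f \<in> wiener" using Hs_wiener[OF s f] by simp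
  show "(\<lambda>z. f z * g z) \<in> L2" by (intro L2_wiener_mult fw Hs_L2[OF g])
  fix K :: "int set" assume K: "finite K"
  define A where "A j = weight s j * (cmod (fourier f j))\<^sup>2" for j
  define B where "B j = weight s j * (cmod (fourier g j))\<^sup>2" for j
  have nn: "A j \<ge> 0" "B j \<ge> 0" for j by (auto simp: A_def B_def)
  show "(\<Sum>k\<in>K. weight s k * (cmod (fourier (\<lambda>z. f z * g z) k))\<^sup>2) \<le>
      (sqrt (algebra_const s) * (hs_norm s f * hs_norm s g))\<^sup>2"
  proof (rule LIMSEQ_le_const2)
    show "(\<lambda>n. \<Sum>k\<in>K. weight s k * (cmod (\<Sum>j\<in>{- int n..int n}. fourier f j * fourier g (k - j)))\<^sup>2)
        \<longlonglongrightarrow> (\<Sum>k\<in>K. weight s k * (cmod (fourier (\<lambda>z. f z * g z) k))\<^sup>2)"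
      by (intro tendsto_intros fourier_wiener_mult fw Hs_L2[OF g])
    show "\<exists>N. \<forall>n\<ge>N. (\<Sum>k\<in>K. weight s k * (cmod (\<Sum>j\<in>{- int n..int n}. fourier f j * fourier g (k - j)))\<^sup>2)
        \<le> (sqrt (algebra_const s) * (hs_norm s f * hs_norm s g))\<^sup>2"
    proof (intro exI allI impI)
      fix n :: nat
      define J where "J = {- int n..int n}"
      have "(\<Sum>k\<in>K. weight s k * (cmod (\<Sum>j\<in>J. fourier f j * fourier g (k - j)))\<^sup>2) \<le>
          (\<Sum>k\<in>K. algebra_const s * (\<Sum>j\<in>J. A j * B (k - j)))"
        unfolding A_def B_def by (intro sum_mono weighted_convolution_le s) (simp add: J_def)
      also have "\<dots> = algebra_const s * (\<Sum>j\<in>J. A j * (\<Sum>k\<in>K. B (k - j)))"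
        unfolding sum_distrib_left by (rule sum.swap)
      also have "\<dots> \<le> algebra_const s * (\<Sum>j\<in>J. A j * (hs_norm s g)\<^sup>2)"
      proof (intro mult_left_mono sum_mono nn)
        fix j
        have "(\<Sum>k\<in>K. B (k - j)) = (\<Sum>i\<in>(\<lambda>k. k - j) ` K. B i)"
          by (subst sum.reindex) (auto simp: inj_on_def)
        also have "\<dots> \<le> (hs_norm s g)\<^sup>2"
          unfolding B_def using K by (intro Hs_sum_le g) simp
        finally show "(\<Sum>k\<in>K. B (k - j)) \<le> (hs_norm s g)\<^sup>2" .
      qed simp
      also have "\<dots> = algebra_const s * ((\<Sum>j\<in>J. A j) * (hs_norm s g)\<^sup>2)"
        by (simp add: sum_distrib_right)
      also have "\<dots> \<le> algebra_const s * ((hs_norm s f)\<^sup>2 * (hs_norm s g)\<^sup>2)"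
        unfolding A_def by (intro mult_left_mono mult_right_mono Hs_sum_le f) (auto simp: J_def)
      finally show "(\<Sum>k\<in>K. weight s k * (cmod (\<Sum>j\<in>{- int n..int n}. fourier f j * fourier g (k - j)))\<^sup>2)
        \<le> (sqrt (algebra_const s) * (hs_norm s f * hs_norm s g))\<^sup>2"
        by (simp add: J_def power_mult_distrib)
    qed
  qed
qed simp

subsection \<open>Hankel and Toeplitz operators\<close>

text \<open>Only AE, because the representatives chosen on the two sides may differ on a null
  set.\<close>

lemma szego_proj_lincomb:
  assumes "f \<in> L2" "g \<in> L2"
  shows "AE z in circ. szego_proj (\<lambda>w. a * f w + b * g w) z = a * szego_proj f z + b * szego_proj g z"
proof (rule L2_plus_eqI)
  show "szego_proj (\<lambda>w. a * f w + b * g w) \<in> L2_plus"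
    by (intro szego_proj_L2_plus L2_add L2_scale assms)
  show "(\<lambda>z. a * szego_proj f z + b * szego_proj g z) \<in> L2_plus"
    by (intro szego_proj_L2_plus L2_plus_add L2_plus_scale assms)
qed (simp add: fourier_szego_proj fourier_add fourier_scale L2_add L2_scale
       L2_plusD(1)[OF szego_proj_L2_plus] assms)

lemma szego_proj_cong_AE:
  assumes "f \<in> L2" "g \<in> L2" "AE z in circ. f z = g z"
  shows "AE z in circ. szego_proj f z = szego_proj g z"
proof (rule L2_plus_eqI)
  show "fourier (szego_proj f) k = fourier (szego_proj g) k" for k
    using fourier_cong_AE[OF L2_measurable L2_measurable assms(3)] assms(1,2)
    by (simp add: fourier_szego_proj)
qed (intro szego_proj_L2_plus assms)+

lemma L2_wiener_cnj_mult: "u \<in> wiener \<Longrightarrow> h \<in> L2 \<Longrightarrow> (\<lambda>z. u z * cnj (h z)) \<in> L2"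
  by (intro L2_wiener_mult L2_cnj)

lemma L2_abs2_mult:
  assumes "u \<in> wiener" "h \<in> L2"
  shows "(\<lambda>z. of_real ((cmod (u z))\<^sup>2) * h z) \<in> L2"
proof -
  have "(\<lambda>z. u z * cnj (u z * cnj (h z))) \<in> L2"
    by (intro L2_wiener_cnj_mult assms)
  then show ?thesis by (simp add: complex_norm_square mult.assoc del: of_real_power)
qed

lemma hankel_L2_plus: "u \<in> wiener \<Longrightarrow> h \<in> L2 \<Longrightarrow> hankel u h \<in> L2_plus"
  unfolding hankel_def by (intro szego_proj_L2_plus L2_wiener_cnj_mult)

lemma toeplitz_L2_plus:
  "u \<in> wiener \<Longrightarrow> h \<in> L2 \<Longrightarrow> toeplitz (\<lambda>w. of_real ((cmod (u w))\<^sup>2)) h \<in> L2_plus"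
  unfolding toeplitz_def by (intro szego_proj_L2_plus L2_abs2_mult)

lemma B_op_L2_plus: "u \<in> wiener \<Longrightarrow> h \<in> L2 \<Longrightarrow> B_op u h \<in> L2_plus"
  unfolding B_op_def
  by (intro L2_plus_diff L2_plus_scale hankel_L2_plus toeplitz_L2_plus) (auto intro: L2_plusD(1)[OF hankel_L2_plus])

lemma commutator_L2_plus: "u \<in> wiener \<Longrightarrow> h \<in> L2 \<Longrightarrow> commutator (B_op u) (hankel u) h \<in> L2_plus"
  unfolding commutator_def
  by (intro L2_plus_diff B_op_L2_plus hankel_L2_plus L2_plusD(1)[OF hankel_L2_plus] L2_plusD(1)[OF B_op_L2_plus])

lemma hankel_lincomb:
  assumes u: "u \<in> wiener" and h: "h \<in> L2" and g: "g \<in> L2"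
  shows "AE z in circ. hankel u (\<lambda>w. a * h w + b * g w) z = cnj a * hankel u h z + cnj b * hankel u g z"
  using szego_proj_lincomb[OF L2_wiener_cnj_mult[OF u h] L2_wiener_cnj_mult[OF u g], of "cnj a" "cnj b"]
  by (simp add: hankel_def ring_distribs mult_ac)

lemma hankel_cong_AE:
  assumes u: "u \<in> wiener" and h: "h \<in> L2" and g: "g \<in> L2" and eq: "AE z in circ. h z = g z"
  shows "AE z in circ. hankel u h z = hankel u g z"
  unfolding hankel_def
proof (rule szego_proj_cong_AE)
  show "AE z in circ. u z * cnj (h z) = u z * cnj (g z)"
    using eq by eventually_elim simp
qed (intro L2_wiener_cnj_mult assms)+

lemma linear_B_op:
  assumes u: "u \<in> wiener"
  shows "linear_op (B_op u)"
  unfolding linear_op_def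
proof (intro conjI ballI allI)
  fix h g a b assume "h \<in> L2_plus" "g \<in> L2_plus"
  then have hg: "h \<in> L2" "g \<in> L2" by (auto dest: L2_plusD)
  note H = L2_plusD(1)[OF hankel_L2_plus[OF u]]
  \<comment> \<open>The inner Hankel operator conjugates the scalars and the outer one conjugates
    them back, so the square is complex linear.\<close>
  have "AE z in circ. hankel u (hankel u (\<lambda>w. a * h w + b * g w)) z =
      hankel u (\<lambda>w. cnj a * hankel u h w + cnj b * hankel u g w) z"
    by (intro hankel_cong_AE hankel_lincomb u H L2_add L2_scale hg)
  moreover have "AE z in circ. hankel u (\<lambda>w. cnj a * hankel u h w + cnj b * hankel u g w) z =
      a * hankel u (hankel u h) z + b * hankel u (hankel u g) z"
    using hankel_lincomb[OF u H[OF hg(1)] H[OF hg(2)], of "cnj a" "cnj b"] by simp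
  moreover have "AE z in circ. toeplitz (\<lambda>w. of_real ((cmod (u w))\<^sup>2)) (\<lambda>w. a * h w + b * g w) z =
      a * toeplitz (\<lambda>w. of_real ((cmod (u w))\<^sup>2)) h z + b * toeplitz (\<lambda>w. of_real ((cmod (u w))\<^sup>2)) g z"
    using szego_proj_lincomb[OF L2_abs2_mult[OF u hg(1)] L2_abs2_mult[OF u hg(2)], of a b]
    by (simp add: toeplitz_def ring_distribs mult_ac)
  ultimately show "AE z in circ. B_op u (\<lambda>w. a * h w + b * g w) z = a * B_op u h z + b * B_op u g z"
    by eventually_elim (simp add: B_op_def algebra_simps)
qed (auto intro: B_op_L2_plus u dest: L2_plusD)

text \<open>Both sides are the integral of u cnj h cnj g, symmetric in \<open>h\<close> and
  \<open>g\<close>. This is the antilinear form of self-adjointness; used twice, it makes the square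
  of the operator symmetric.\<close>

lemma ip_hankel_commute:
  assumes u: "u \<in> wiener" and h: "h \<in> L2_plus" and g: "g \<in> L2_plus"
  shows "ip (hankel u h) g = ip (hankel u g) h"
proof -
  have "ip (hankel u h) g = ip (\<lambda>z. u z * cnj (h z)) g"
    unfolding hankel_def by (intro ip_szego_proj L2_wiener_cnj_mult u L2_plusD(1)[OF h] g)
  also have "\<dots> = ip (\<lambda>z. u z * cnj (g z)) h"
    by (simp add: ip_def mult_ac)
  also have "\<dots> = ip (hankel u g) h"
    unfolding hankel_def by (intro ip_szego_proj[symmetric] L2_wiener_cnj_mult u L2_plusD(1)[OF g] h)
  finally show ?thesis .
qed

lemma ip_hankel_hankel:
  assumes u: "u \<in> wiener" and h: "h \<in> L2_plus" and g: "g \<in> L2_plus"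
  shows "ip (hankel u (hankel u h)) g = ip h (hankel u (hankel u g))"
proof -
  note H = hankel_L2_plus[OF u L2_plusD(1)]
  have "ip (hankel u (hankel u h)) g = ip (hankel u g) (hankel u h)"
    by (rule ip_hankel_commute[OF u H[OF h] g])
  also have "\<dots> = cnj (ip (hankel u (hankel u g)) h)"
    by (subst ip_commute) (simp add: ip_hankel_commute[OF u H[OF g] h])
  also have "\<dots> = ip h (hankel u (hankel u g))"
    by (rule ip_commute[symmetric])
  finally show ?thesis .
qed

lemma ip_toeplitz:
  assumes u: "u \<in> wiener" and h: "h \<in> L2_plus" and g: "g \<in> L2_plus"
  defines "T \<equiv> toeplitz (\<lambda>w. of_real ((cmod (u w))\<^sup>2))"
  shows "ip (T h) g = ip h (T g)"
proof -
  have *: "ip (T h) g = ip (\<lambda>z. of_real ((cmod (u z))\<^sup>2) * h z) g"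
    if "h \<in> L2_plus" "g \<in> L2_plus" for h g
    unfolding T_def toeplitz_def by (intro ip_szego_proj L2_abs2_mult u L2_plusD(1)[OF that(1)] that)
  have "ip h (T g) = cnj (ip (\<lambda>z. of_real ((cmod (u z))\<^sup>2) * g z) h)"
    by (subst ip_commute) (simp add: *[OF g h])
  also have "\<dots> = ip (\<lambda>z. of_real ((cmod (u z))\<^sup>2) * h z) g"
    unfolding ip_def Bochner_Integration.integral_cnj[symmetric] by (simp add: mult_ac)
  finally show ?thesis by (simp add: *[OF h g])
qed

text \<open>The square of the Hankel operator is symmetric, and so is the Toeplitz operator because
  its symbol is real; the imaginary factors make the combination skew.\<close>

theorem skew_symmetric_B_op:
  assumes u: "u \<in> wiener"
  shows "skew_symmetric_op (B_op u)"
  unfolding skew_symmetric_op_def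
proof (intro conjI ballI linear_B_op u)
  fix h g assume h: "h \<in> L2_plus" and g: "g \<in> L2_plus"
  define T where "T = toeplitz (\<lambda>w. of_real ((cmod (u w))\<^sup>2))"
  define H2 where "H2 h = hankel u (hankel u h)" for h
  have B: "ip (B_op u h) g = \<i> / 2 * ip (H2 h) g - \<i> * ip (T h) g"
    if "h \<in> L2_plus" "g \<in> L2_plus" for h g
  proof -
    have "H2 h \<in> L2" "T h \<in> L2"
      unfolding H2_def T_def
      by (intro L2_plusD(1)[OF hankel_L2_plus] L2_plusD(1)[OF toeplitz_L2_plus] u L2_plusD(1)[OF that(1)])+
    then have "ip (\<lambda>z. \<i> / 2 * H2 h z - \<i> * T h z) g = \<i> / 2 * ip (H2 h) g - \<i> * ip (T h) g"
      by (simp only: ip_diff_left[OF L2_scale L2_scale L2_plusD(1)[OF that(2)]] ip_scale_left)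
    then show ?thesis by (simp add: B_op_def H2_def T_def)
  qed
  have "ip h (B_op u g) = cnj (\<i> / 2 * ip (H2 g) h - \<i> * ip (T g) h)"
    by (subst ip_commute) (simp only: B[OF g h])
  also have "\<dots> = - \<i> / 2 * cnj (ip (H2 g) h) + \<i> * cnj (ip (T g) h)"
    by simp
  also have "cnj (ip (H2 g) h) = ip (H2 h) g"
    unfolding H2_def by (simp add: ip_commute[symmetric] ip_hankel_hankel[OF u h g])
  also have "cnj (ip (T g) h) = ip (T h) g"
    unfolding T_def by (simp only: ip_commute[symmetric] ip_toeplitz[OF u h g])
  finally show "ip (B_op u h) g = - ip h (B_op u g)"
    by (simp add: B[OF h g])
qed

text \<open>
  With \<open>q\<close> the conjugate of \<open>(1 - \<Pi>)(u cnj h)\<close>, which lies in \<open>L2_plus\<close>, the product \<open>u q\<close> is in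
  \<open>L2_plus\<close> as well, so that it equals its own projection \<open>T h - H\<^sup>2 h\<close> for \<open>T\<close> the Toeplitz operator.
\<close>

lemma commutator_B_hankel:
  assumes u: "u \<in> wiener" "u \<in> L2_plus" and h: "h \<in> L2_plus"
  shows "AE z in circ. commutator (B_op u) (hankel u) h z =
    - \<i> * szego_proj (\<lambda>w. of_real ((cmod (u w))\<^sup>2) * u w * cnj (h w)) z"
proof -
  note hL = L2_plusD(1)[OF h]
  define b where "b w = complex_of_real ((cmod (u w))\<^sup>2)" for w
  define G where "G = hankel u h"
  define T where "T = toeplitz b"
  define q where "q w = cnj (u w * cnj (h w) - G w)" for w
  have b: "b w = u w * cnj (u w)" for w
    by (simp only: b_def complex_norm_square)
  have G: "G \<in> L2_plus" unfolding G_def by (intro hankel_L2_plus u hL)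
  note GL = L2_plusD(1)[OF G]
  have HG: "hankel u G \<in> L2_plus" by (intro hankel_L2_plus u GL)
  note HGL = L2_plusD(1)[OF HG]
  have Th: "T h \<in> L2_plus" unfolding T_def b_def[abs_def] by (intro toeplitz_L2_plus u hL)
  note ThL = L2_plusD(1)[OF Th]
  have bh: "(\<lambda>z. b z * k z) \<in> L2" if "k \<in> L2" for k
    unfolding b_def by (intro L2_abs2_mult u that)
  have q: "q \<in> L2_plus"
  proof (rule L2_plusI)
    show "q \<in> L2"
      unfolding q_def[abs_def] by (intro L2_cnj L2_diff L2_wiener_cnj_mult u hL GL)
    \<comment> \<open>Conjugation moves \<open>k\<close> to - k > 0, where u cnj h and its
      projection \<open>G\<close> have the same coefficient.\<close>
    fix k :: int assume "k < 0"
    then show "fourier q k = 0"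
      unfolding q_def[abs_def] fourier_cnj fourier_diff[OF L2_wiener_cnj_mult[OF u(1) hL] GL]
      unfolding G_def hankel_def
      by (simp add: fourier_szego_proj L2_wiener_cnj_mult u hL)
  qed
  have uq: "(\<lambda>z. u z * q z) \<in> L2_plus"
    by (rule L2_plus_wiener_mult[OF u q])
  have uq_eq: "AE z in circ. u z * q z = T h z - hankel u G z"
  proof (rule L2_plus_eqI[OF uq L2_plus_diff[OF Th HG]])
    fix k :: int assume k: "k \<ge> 0"
    have "(\<lambda>z. u z * q z) = (\<lambda>z. b z * h z - u z * cnj (G z))"
      by (auto simp: q_def b algebra_simps)
    then have "fourier (\<lambda>z. u z * q z) k = fourier (\<lambda>z. b z * h z) k - fourier (\<lambda>z. u z * cnj (G z)) k"
      by (simp add: fourier_diff bh hL L2_wiener_cnj_mult u GL)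
    also have "\<dots> = fourier (T h) k - fourier (hankel u G) k"
      unfolding T_def toeplitz_def hankel_def using k
      by (simp add: fourier_szego_proj bh hL L2_wiener_cnj_mult u GL)
    finally show "fourier (\<lambda>z. u z * q z) k = fourier (\<lambda>z. T h z - hankel u G z) k"
      by (simp add: fourier_diff ThL HGL)
  qed
  have uL: "(\<lambda>z. u z * cnj (k z)) \<in> L2" if "k \<in> L2" for k
    by (intro L2_wiener_cnj_mult u that)
  have Bh: "B_op u h = (\<lambda>z. \<i> / 2 * hankel u G z - \<i> * T h z)"
    by (simp add: B_op_def G_def T_def b_def[abs_def])
  have BhL: "B_op u h \<in> L2"
    by (rule L2_plusD(1)[OF B_op_L2_plus[OF u(1) hL]])
  have main: "AE z in circ. commutator (B_op u) (hankel u) h z = szego_proj (\<lambda>w. - \<i> * (b w * (u w * cnj (h w)))) z"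
  proof (rule L2_plus_eqI)
    show "commutator (B_op u) (hankel u) h \<in> L2_plus"
      by (intro commutator_L2_plus u hL)
    show "szego_proj (\<lambda>w. - \<i> * (b w * (u w * cnj (h w)))) \<in> L2_plus"
      by (intro szego_proj_L2_plus L2_scale bh uL hL)
    fix k :: int assume k: "k \<ge> 0"
    define F where "F f = fourier f k" for f
    have F_hankel: "F (hankel u f) = F (\<lambda>z. u z * cnj (f z))" if "f \<in> L2" for f
      unfolding F_def hankel_def using k by (simp add: fourier_szego_proj uL that)
    have F_T: "F (T f) = F (\<lambda>z. b z * f z)" if "f \<in> L2" for f
      unfolding F_def T_def toeplitz_def using k by (simp add: fourier_szego_proj bh that)
    have "F (commutator (B_op u) (hankel u) h) = F (B_op u G) - F (hankel u (B_op u h))"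
      unfolding commutator_def G_def[symmetric] F_def
      by (intro fourier_diff L2_plusD(1)[OF B_op_L2_plus] L2_plusD(1)[OF hankel_L2_plus] u GL BhL)
    also have "F (B_op u G) = \<i> / 2 * F (\<lambda>z. u z * cnj (hankel u G z)) - \<i> * F (\<lambda>z. b z * G z)"
    proof -
      have "T G \<in> L2" "hankel u (hankel u G) \<in> L2"
        unfolding T_def b_def[abs_def]
        by (intro L2_plusD(1)[OF toeplitz_L2_plus] L2_plusD(1)[OF hankel_L2_plus] u GL HGL)+
      moreover have "B_op u G = (\<lambda>z. \<i> / 2 * hankel u (hankel u G) z - \<i> * T G z)"
        by (simp add: B_op_def T_def b_def[abs_def])
      ultimately have "F (B_op u G) = \<i> / 2 * F (hankel u (hankel u G)) - \<i> * F (T G)"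
        unfolding F_def by (simp only: fourier_diff[OF L2_scale L2_scale] fourier_scale)
      then show ?thesis
        by (simp only: F_hankel[OF HGL] F_T[OF GL])
    qed
    also have "F (hankel u (B_op u h)) = F (\<lambda>z. u z * cnj (B_op u h z))"
      by (rule F_hankel[OF BhL])
    \<comment> \<open>Conjugation reverses the sign of both imaginary factors: the two cubic terms,
      each with weight 1/2, will add up to one instead of cancelling.\<close>
    also have "(\<lambda>z. u z * cnj (B_op u h z)) =
        (\<lambda>z. (- \<i> / 2) * (u z * cnj (hankel u G z)) + \<i> * (u z * cnj (T h z)))"
      by (simp add: Bh algebra_simps)
    also have "F \<dots> = (- \<i> / 2) * F (\<lambda>z. u z * cnj (hankel u G z)) + \<i> * F (\<lambda>z. u z * cnj (T h z))"
      unfolding F_def by (simp only: fourier_add[OF L2_scale[OF uL[OF HGL]] L2_scale[OF uL[OF ThL]]] fourier_scale)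
    also have "\<i> / 2 * F (\<lambda>z. u z * cnj (hankel u G z)) - \<i> * F (\<lambda>z. b z * G z) -
        ((- \<i> / 2) * F (\<lambda>z. u z * cnj (hankel u G z)) + \<i> * F (\<lambda>z. u z * cnj (T h z))) =
        - \<i> * (F (\<lambda>z. u z * cnj (T h z)) - F (\<lambda>z. u z * cnj (hankel u G z)) + F (\<lambda>z. b z * G z))"
      by (simp add: algebra_simps)
    also have "F (\<lambda>z. u z * cnj (T h z)) - F (\<lambda>z. u z * cnj (hankel u G z)) =
        F (\<lambda>z. u z * cnj (T h z) - u z * cnj (hankel u G z))"
      unfolding F_def by (intro fourier_diff[symmetric] uL HGL ThL)
    also have "\<dots> = F (\<lambda>z. u z * cnj (u z * q z))"
      unfolding F_def
    proof (rule fourier_cong_AE)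
      show "AE z in circ. u z * cnj (T h z) - u z * cnj (hankel u G z) = u z * cnj (u z * q z)"
        using uq_eq by eventually_elim (simp add: right_diff_distrib)
    qed (intro L2_measurable L2_diff uL HGL ThL L2_plusD(1)[OF uq])+
    also have "F (\<lambda>z. u z * cnj (u z * q z)) + F (\<lambda>z. b z * G z) =
        F (\<lambda>z. u z * cnj (u z * q z) + b z * G z)"
      unfolding F_def by (intro fourier_add[symmetric] uL bh GL L2_plusD(1)[OF uq])
    \<comment> \<open>Since cnj q = u cnj h - G, the first summand is b (u cnj h - G), and
      \<open>G\<close> drops out.\<close>
    also have "(\<lambda>z. u z * cnj (u z * q z) + b z * G z) = (\<lambda>z. b z * (u z * cnj (h z)))"
      by (auto simp: q_def b algebra_simps)
    also have "- \<i> * F (\<lambda>z. b z * (u z * cnj (h z))) = F (\<lambda>z. - \<i> * (b z * (u z * cnj (h z))))"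
      unfolding F_def by (rule fourier_scale[symmetric])
    finally show "fourier (commutator (B_op u) (hankel u) h) k =
        fourier (szego_proj (\<lambda>w. - \<i> * (b w * (u w * cnj (h w))))) k"
      unfolding F_def using k by (simp only: fourier_szego_proj[OF L2_scale[OF bh[OF uL[OF hL]]]] if_True)
  qed
  have X: "(\<lambda>w. b w * (u w * cnj (h w))) \<in> L2" by (intro bh uL hL)
  from szego_proj_lincomb[OF X X, of "- \<i>" 0] main show ?thesis
    by eventually_elim (simp add: b_def mult.assoc)
qed

section \<open>Hankel operators with projected symbols\<close>

lemma wiener_szego_proj:
  assumes f: "f \<in> wiener"
  shows "szego_proj f \<in> wiener"
proof -
  note L = wiener_L2[OF f]
  have "(\<lambda>k. cmod (fourier (szego_proj f) k)) summable_on UNIV"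
    by (rule summable_on_comparison_test[OF wiener_summable[OF f]]) (auto simp: fourier_szego_proj L)
  then show ?thesis
    using szego_proj_L2_plus[OF L] by (simp add: wiener_def L2_plusD)
qed

lemma wiener_diff:
  assumes f: "f \<in> wiener" and g: "g \<in> wiener"
  shows "(\<lambda>z. f z - g z) \<in> wiener"
proof -
  note L = wiener_L2[OF f] wiener_L2[OF g]
  have "(\<lambda>k. cmod (fourier f k) + cmod (fourier g k)) summable_on UNIV"
    by (intro summable_on_add wiener_summable f g)
  then have "(\<lambda>k. cmod (fourier (\<lambda>z. f z - g z) k)) summable_on UNIV"
    by (rule summable_on_comparison_test) (auto simp: fourier_diff L norm_triangle_ineq4)
  then show ?thesis using L by (simp add: wiener_def L2_diff)
qed

text \<open>The conjugate of \<open>h\<close> has frequencies at most 0, so its product with the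
  negative-frequency part of \<open>f\<close> has only negative frequencies, and the outer
  projection removes them.\<close>

lemma hankel_szego_proj:
  assumes f: "f \<in> wiener" and h: "h \<in> L2_plus"
  shows "AE z in circ. hankel (szego_proj f) h z = hankel f h z"
proof (rule L2_plus_eqI)
  note hL = L2_plusD(1)[OF h] and P = wiener_szego_proj[OF f]
  show "hankel (szego_proj f) h \<in> L2_plus" "hankel f h \<in> L2_plus"
    by (intro hankel_L2_plus P f hL)+
  fix k :: int assume k: "k \<ge> 0"
  define g where "g z = f z - szego_proj f z" for z
  have g: "g \<in> wiener"
    unfolding g_def[abs_def] by (intro wiener_diff f P)
  have zero: "fourier g j * fourier (\<lambda>z. cnj (h z)) (k - j) = 0" for j
  proof (cases "j \<ge> 0")
    case True
    then show ?thesis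
      unfolding g_def[abs_def]
      by (simp add: fourier_diff fourier_szego_proj wiener_L2[OF f] wiener_L2[OF P])
  next
    case False
    then show ?thesis
      using L2_plusD(2)[OF h, of "j - k"] k by (simp add: fourier_cnj)
  qed
  have "fourier (\<lambda>z. g z * cnj (h z)) k = 0"
    using fourier_wiener_mult[OF g L2_cnj[OF hL], of k] unfolding zero by (simp add: LIMSEQ_const_iff)
  moreover have "fourier (\<lambda>z. g z * cnj (h z)) k =
      fourier (\<lambda>z. f z * cnj (h z)) k - fourier (\<lambda>z. szego_proj f z * cnj (h z)) k"
    unfolding g_def left_diff_distrib by (intro fourier_diff L2_wiener_cnj_mult f P hL)
  ultimately show "fourier (hankel (szego_proj f) h) k = fourier (hankel f h) k"
    using k by (simp add: hankel_def fourier_szego_proj L2_wiener_cnj_mult f P hL)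
qed

subsection \<open>The cubic nonlinearity\<close>

lemma cubic_eq: "(\<lambda>w. of_real ((cmod (u w))\<^sup>2) * u w) = (\<lambda>w. u w * (u w * cnj (u w)))"
  by (simp only: complex_norm_square mult_ac)

lemma Hs_cubic:
  "s > 1 / 2 \<Longrightarrow> u \<in> Hs s \<Longrightarrow> (\<lambda>w. of_real ((cmod (u w))\<^sup>2) * u w) \<in> Hs s"
  unfolding cubic_eq by (intro conjunct1[OF Hs_mult] conjunct1[OF Hs_cnj])

lemma Hs_plusD: "u \<in> Hs_plus s \<Longrightarrow> u \<in> Hs s" "u \<in> Hs_plus s \<Longrightarrow> u \<in> L2_plus"
  by (auto simp: plus_part_def Hs_L2)

lemma tendsto_hs_norm_mult:
  assumes s: "s > 1 / 2" and Hs: "\<And>x. f x \<in> Hs s" "\<And>x. g x \<in> Hs s" "f0 \<in> Hs s" "g0 \<in> Hs s"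
    and f: "((\<lambda>x. hs_norm s (\<lambda>z. f x z - f0 z)) \<longlongrightarrow> 0) A"
    and g: "((\<lambda>x. hs_norm s (\<lambda>z. g x z - g0 z)) \<longlongrightarrow> 0) A"
  shows "((\<lambda>x. hs_norm s (\<lambda>z. f x z * g x z - f0 z * g0 z)) \<longlongrightarrow> 0) A"
proof (rule Lim_null_comparison)
  define C where "C = sqrt (algebra_const s)"
  define p where "p x = hs_norm s (\<lambda>z. f x z - f0 z)" for x
  define q where "q x = hs_norm s (\<lambda>z. g x z - g0 z)" for x
  show "\<forall>\<^sub>F x in A. norm (hs_norm s (\<lambda>z. f x z * g x z - f0 z * g0 z)) \<le>
      2 * (C * (p x * q x) + 2 * (C * (hs_norm s f0 * q x) + C * (p x * hs_norm s g0)))"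
  proof (intro always_eventually allI)
    fix x
    note d = Hs_diff[OF Hs(1)[of x] Hs(3)] Hs_diff[OF Hs(2)[of x] Hs(4)]
    note m = Hs_mult[OF s d] Hs_mult[OF s Hs(3) d(2)] Hs_mult[OF s d(1) Hs(4)]
    note a = Hs_add[OF conjunct1[OF m(2)] conjunct1[OF m(3)]]
    note b = Hs_add[OF conjunct1[OF m(1)] conjunct1[OF a]]
    \<comment> \<open>Expanding around \<open>f0\<close> and \<open>g0\<close> leaves only fixed
      norms and norms tending to 0, so no separate bound on the norms of \<open>f x\<close> and
      \<open>g x\<close> is required.\<close>
    have "(\<lambda>z. f x z * g x z - f0 z * g0 z) =
        (\<lambda>z. (f x z - f0 z) * (g x z - g0 z) + (f0 z * (g x z - g0 z) + (f x z - f0 z) * g0 z))"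
      by (simp add: algebra_simps)
    then show "norm (hs_norm s (\<lambda>z. f x z * g x z - f0 z * g0 z)) \<le>
      2 * (C * (p x * q x) + 2 * (C * (hs_norm s f0 * q x) + C * (p x * hs_norm s g0)))"
      using m a b unfolding C_def p_def q_def by simp
  qed
  have "((\<lambda>x. 2 * (C * (p x * q x) + 2 * (C * (hs_norm s f0 * q x) + C * (p x * hs_norm s g0)))) \<longlongrightarrow>
      2 * (C * (0 * 0) + 2 * (C * (hs_norm s f0 * 0) + C * (0 * hs_norm s g0)))) A"
    unfolding p_def q_def by (intro tendsto_intros f g)
  then show "((\<lambda>x. 2 * (C * (p x * q x) + 2 * (C * (hs_norm s f0 * q x) + C * (p x * hs_norm s g0)))) \<longlongrightarrow> 0) A"
    by simp
qed

lemma tendsto_hs_norm_cubic: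
  assumes s: "s > 1 / 2" and Hs: "\<And>x. f x \<in> Hs s" "g \<in> Hs s"
    and f: "((\<lambda>x. hs_norm s (\<lambda>z. f x z - g z)) \<longlongrightarrow> 0) A"
  shows "((\<lambda>x. hs_norm s (\<lambda>z. of_real ((cmod (f x z))\<^sup>2) * f x z - of_real ((cmod (g z))\<^sup>2) * g z)) \<longlongrightarrow> 0) A"
proof -
  note cnj = conjunct1[OF Hs_cnj]
  have "((\<lambda>x. hs_norm s (\<lambda>z. cnj (f x z) - cnj (g z))) \<longlongrightarrow> 0) A"
  proof (rule Lim_null_comparison[OF _ f])
    show "\<forall>\<^sub>F x in A. norm (hs_norm s (\<lambda>z. cnj (f x z) - cnj (g z))) \<le> hs_norm s (\<lambda>z. f x z - g z)"
      using conjunct2[OF Hs_cnj[OF Hs_diff[OF Hs]]] by (intro always_eventually allI) simp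
  qed
  then have "((\<lambda>x. hs_norm s (\<lambda>z. f x z * (f x z * cnj (f x z)) - g z * (g z * cnj (g z)))) \<longlongrightarrow> 0) A"
    by (intro tendsto_hs_norm_mult s Hs f conjunct1[OF Hs_mult] cnj)
  moreover have "(\<lambda>z. of_real ((cmod (f x z))\<^sup>2) * f x z - of_real ((cmod (g z))\<^sup>2) * g z) =
      (\<lambda>z. f x z * (f x z * cnj (f x z)) - g z * (g z * cnj (g z)))" for x
    by (simp only: complex_norm_square mult_ac)
  ultimately show ?thesis by simp
qed

definition szego_field :: "(complex \<Rightarrow> complex) \<Rightarrow> complex \<Rightarrow> complex" where
  "szego_field u z = - \<i> * szego_proj (\<lambda>w. of_real ((cmod (u w))\<^sup>2) * u w) z"

lemma szego_field_Hs_plus: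
  assumes "s > 1 / 2" "u \<in> Hs s"
  shows "szego_field u \<in> Hs_plus s"
proof -
  have P: "szego_proj (\<lambda>w. of_real ((cmod (u w))\<^sup>2) * u w) \<in> Hs_plus s"
    using Hs_szego_proj[OF Hs_cubic[OF assms]] by simp
  then show ?thesis
    using conjunct1[OF Hs_scale[OF Hs_plusD(1)[OF P]], of "- \<i>"] L2_plus_scale[OF Hs_plusD(2)[OF P], of "- \<i>"]
    by (simp add: szego_field_def[abs_def] plus_part_def)
qed

lemma fourier_szego_field:
  assumes "s > 1 / 2" "u \<in> Hs s"
  shows "fourier (szego_field u) k =
    (if k \<ge> 0 then - \<i> * fourier (\<lambda>w. of_real ((cmod (u w))\<^sup>2) * u w) k else 0)"
  unfolding szego_field_def[abs_def] fourier_scale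
  using fourier_szego_proj[OF Hs_L2[OF Hs_cubic[OF assms]]] by simp

text \<open>Linear in the symbol although antilinear in the argument: scalars such as - i move into
  the symbol unconjugated.\<close>

lemma hankel_symbol_lincomb:
  assumes u: "u \<in> wiener" and v: "v \<in> wiener" and h: "h \<in> L2"
  shows "AE z in circ. hankel (\<lambda>w. a * u w + b * v w) h z = a * hankel u h z + b * hankel v h z"
  using szego_proj_lincomb[OF L2_wiener_cnj_mult[OF u h] L2_wiener_cnj_mult[OF v h], of a b]
  by (simp add: hankel_def ring_distribs mult_ac)

lemma hankel_symbol_cong_AE:
  assumes "u \<in> wiener" "v \<in> wiener" "h \<in> L2" and eq: "AE z in circ. u z = v z"
  shows "AE z in circ. hankel u h z = hankel v h z"
  unfolding hankel_def
proof (rule szego_proj_cong_AE)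
  show "AE z in circ. u z * cnj (h z) = v z * cnj (h z)"
    using eq by eventually_elim simp
qed (intro L2_wiener_cnj_mult assms)+

lemma commutator_eq_hankel_szego_field:
  assumes s: "s > 1 / 2" and u: "u \<in> Hs_plus s" and h: "h \<in> L2_plus"
  shows "AE z in circ. commutator (B_op u) (hankel u) h z = hankel (szego_field u) h z"
proof -
  define c where "c w = of_real ((cmod (u w))\<^sup>2) * u w" for w
  have uw: "u \<in> wiener" using Hs_wiener[OF s Hs_plusD(1)[OF u]] by simp
  have cw: "c \<in> wiener"
    using Hs_wiener[OF s Hs_cubic[OF s Hs_plusD(1)[OF u]]] by (simp add: c_def[abs_def])
  have "AE z in circ. commutator (B_op u) (hankel u) h z = - \<i> * hankel c h z"
    using commutator_B_hankel[OF uw Hs_plusD(2)[OF u] h] by (simp add: hankel_def c_def)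
  moreover have "AE z in circ. hankel (szego_proj c) h z = hankel c h z"
    by (rule hankel_szego_proj[OF cw h])
  moreover have "AE z in circ. hankel (szego_field u) h z = - \<i> * hankel (szego_proj c) h z"
    using hankel_symbol_lincomb[OF wiener_szego_proj[OF cw] wiener_szego_proj[OF cw] L2_plusD(1)[OF h], of "- \<i>" 0]
    by (simp add: szego_field_def[abs_def] c_def[abs_def])
  ultimately show ?thesis by eventually_elim simp
qed

text \<open>The projection is a contraction, and the Sobolev embedding bounds the symbol by its H^s
  norm almost everywhere.\<close>

lemma l2norm_hankel_le:
  assumes s: "s > 1 / 2" and u: "u \<in> Hs s" and h: "h \<in> L2"
  shows "l2norm (hankel u h) \<le> sqrt (sobolev_const s) * hs_norm s u * l2norm h"
proof -
  have L: "(\<lambda>z. u z * cnj (h z)) \<in> L2"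
    using Hs_wiener[OF s u] by (intro L2_wiener_cnj_mult h) simp
  have "l2norm (hankel u h) \<le> l2norm (\<lambda>z. u z * cnj (h z))"
    unfolding hankel_def by (rule l2norm_szego_proj_le[OF L])
  also have "\<dots> \<le> sqrt (sobolev_const s) * hs_norm s u * l2norm h"
  proof (rule l2norm_mono_bound)
    show "AE z in circ. cmod (u z * cnj (h z)) \<le> sqrt (sobolev_const s) * hs_norm s u * cmod (h z)"
      using Hs_bounded[OF s u] by eventually_elim (simp add: norm_mult mult_right_mono)
  qed (use L h in \<open>auto intro: L2_measurable\<close>)
  finally show ?thesis .
qed

subsection \<open>The Lax pair\<close>

lemma cubic_szego_imp_lax:
  assumes s: "s > 1 / 2" and u: "\<And>t. u t \<in> Hs_plus s"
    and v: "has_Hs_derivative s u v t"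
    and eq: "AE z in circ. \<i> * v z = szego_proj (\<lambda>w. of_real ((cmod (u t w))\<^sup>2) * u t w) z"
  shows "has_op_derivative (\<lambda>\<tau>. hankel (u \<tau>)) (commutator (B_op (u t)) (hankel (u t))) t"
  unfolding has_op_derivative_def
proof (intro conjI ballI allI impI)
  note wiener = conjunct1[OF Hs_wiener[OF s]]
  note uH = Hs_plusD(1)[OF u]
  have vH: "v \<in> Hs s" using v by (auto simp: has_Hs_derivative_def Hs_plusD)
  let ?D = "commutator (B_op (u t)) (hankel (u t))"
  show "?D h \<in> L2_plus" if "h \<in> L2_plus" for h
    by (intro commutator_L2_plus wiener uH L2_plusD(1)[OF that])
  fix e :: real assume e: "e > 0"
  define C where "C = sqrt (sobolev_const s)"
  define w where "w r z = (u (t + r) z - u t z) / of_real r - v z" for r z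
  have C: "C \<ge> 0" by (simp add: C_def)
  \<comment> \<open>\<open>C + 1\<close> keeps the denominator positive, as only C >= 0 is at
    hand.\<close>
  have "\<forall>\<^sub>F r in at 0. hs_norm s (w r) < e / (C + 1)"
    using v e C unfolding has_Hs_derivative_def w_def by (intro order_tendstoD(2)) auto
  then show "\<forall>\<^sub>F r in at 0. \<forall>h\<in>L2_plus.
      l2norm (\<lambda>z. (hankel (u (t + r)) h z - hankel (u t) h z) / of_real r - ?D h z) \<le> e * l2norm h"
  proof eventually_elim
    case (elim r)
    have d: "(\<lambda>z. 1 / of_real r * u (t + r) z + - (1 / of_real r) * u t z) \<in> Hs s"
      by (intro conjunct1[OF Hs_add] conjunct1[OF Hs_scale] uH)
    \<comment> \<open>Written as nested linear combinations, so that linearity in the symbol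
      identifies the error of the operator quotient with the Hankel operator of symbol
      \<open>w r\<close>.\<close>
    have w_eq: "w r = (\<lambda>z. 1 * (1 / of_real r * u (t + r) z + - (1 / of_real r) * u t z) + - 1 * v z)"
      by (auto simp: w_def diff_divide_distrib)
    have w: "w r \<in> Hs s"
      unfolding w_eq by (intro conjunct1[OF Hs_add] conjunct1[OF Hs_scale] uH vH)
    show ?case
    proof
      fix h assume h: "h \<in> L2_plus"
      note hL = L2_plusD(1)[OF h]
      have "AE z in circ. v z = szego_field (u t) z"
        using eq
      proof eventually_elim
        case (elim z)
        have "v z = - \<i> * (\<i> * v z)" by (simp flip: mult.assoc)
        with elim show ?case by (simp only: szego_field_def)
      qed
      then have "AE z in circ. hankel v h z = hankel (szego_field (u t)) h z"
        by (intro hankel_symbol_cong_AE wiener vH hL Hs_plusD(1)[OF szego_field_Hs_plus] s uH)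
      with commutator_eq_hankel_szego_field[OF s u h]
        hankel_symbol_lincomb[OF wiener[OF d] wiener[OF vH] hL, of 1 "- 1"]
        hankel_symbol_lincomb[OF wiener[OF uH] wiener[OF uH] hL, of "1 / of_real r" "t + r" "- (1 / of_real r)" t]
      have ae: "AE z in circ. (hankel (u (t + r)) h z - hankel (u t) h z) / of_real r - ?D h z = hankel (w r) h z"
        unfolding w_eq by eventually_elim (simp add: diff_divide_distrib)
      note H = L2_plusD(1)[OF hankel_L2_plus[OF wiener hL]]
      have "(\<lambda>z. 1 / of_real r * (hankel (u (t + r)) h z - hankel (u t) h z) - ?D h z) \<in> L2"
        by (intro L2_diff L2_scale H uH L2_plusD(1)[OF commutator_L2_plus] wiener hL)
      then have "l2norm (\<lambda>z. (hankel (u (t + r)) h z - hankel (u t) h z) / of_real r - ?D h z) = l2norm (hankel (w r) h)"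
        by (intro l2norm_cong_AE[OF _ _ ae]) (auto intro: L2_measurable H w)
      also have "\<dots> \<le> C * hs_norm s (w r) * l2norm h"
        unfolding C_def by (rule l2norm_hankel_le[OF s w hL])
      also have "\<dots> \<le> e * l2norm h"
      proof (rule mult_right_mono)
        have "C * hs_norm s (w r) \<le> (C + 1) * (e / (C + 1))"
          using elim C by (intro mult_mono) auto
        then show "C * hs_norm s (w r) \<le> e" using C by simp
      qed simp
      finally show "l2norm (\<lambda>z. (hankel (u (t + r)) h z - hankel (u t) h z) / of_real r - ?D h z) \<le> e * l2norm h" .
    qed
  qed
qed

section \<open>From the Lax equation back to the Szego equation\<close>

lemma hankel_one: "u \<in> L2_plus \<Longrightarrow> AE z in circ. hankel u (\<lambda>_. 1) z = u z"
  using szego_proj_ident by (simp add: hankel_def)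

lemma lax_imp_fourier_derivative:
  assumes s: "s > 1 / 2" and u: "\<And>t. u t \<in> Hs_plus s"
    and lax: "has_op_derivative (\<lambda>\<tau>. hankel (u \<tau>)) (commutator (B_op (u t)) (hankel (u t))) t"
  shows "((\<lambda>r. (fourier (u (t + r)) k - fourier (u t) k) / of_real r) \<longlongrightarrow> fourier (szego_field (u t)) k) (at 0)"
proof -
  let ?D = "commutator (B_op (u t)) (hankel (u t))"
  note uL = Hs_plusD(2)[OF u]
  note F = Hs_plusD(2)[OF szego_field_Hs_plus[OF s Hs_plusD(1)[OF u[of t]]]]
  have one: "(\<lambda>_. 1) \<in> L2_plus" using L2_plus_powi[of 0] by simp
  have l2_one: "l2norm (\<lambda>_. 1) = 1" using l2norm_powi[of 0] by simp
  have D: "AE z in circ. ?D (\<lambda>_. 1) z = szego_field (u t) z"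
    using commutator_eq_hankel_szego_field[OF s u[of t] one] hankel_one[OF F] by eventually_elim simp
  have w: "(\<lambda>z. 1 / of_real r * (u (t + r) z - u t z) - szego_field (u t) z) \<in> L2" for r
    by (intro L2_diff L2_scale L2_plusD(1)[OF uL] L2_plusD(1)[OF F])
  have "((\<lambda>r. (fourier (u (t + r)) k - fourier (u t) k) / of_real r - fourier (szego_field (u t)) k) \<longlongrightarrow> 0) (at 0)"
  proof (rule tendstoI)
    fix e :: real assume e: "e > 0"
    then have "\<forall>\<^sub>F r in at 0. \<forall>h\<in>L2_plus.
      l2norm (\<lambda>z. (hankel (u (t + r)) h z - hankel (u t) h z) / of_real r - ?D h z) \<le> e / 2 * l2norm h"
      using lax unfolding has_op_derivative_def by (meson half_gt_zero)
    then show "\<forall>\<^sub>F r in at 0. dist ((fourier (u (t + r)) k - fourier (u t) k) / of_real r -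
        fourier (szego_field (u t)) k) 0 < e"
    proof eventually_elim
      case (elim r)
      note H = L2_plusD(1)[OF hankel_L2_plus[OF conjunct1[OF Hs_wiener[OF s Hs_plusD(1)[OF u]]] L2_plusD(1)[OF one]]]
      have ae: "AE z in circ. (hankel (u (t + r)) (\<lambda>_. 1) z - hankel (u t) (\<lambda>_. 1) z) / of_real r - ?D (\<lambda>_. 1) z =
          1 / of_real r * (u (t + r) z - u t z) - szego_field (u t) z"
        using D hankel_one[OF uL, of "t + r"] hankel_one[OF uL, of t] by eventually_elim simp
      have "(\<lambda>z. 1 / of_real r * (hankel (u (t + r)) (\<lambda>_. 1) z - hankel (u t) (\<lambda>_. 1) z) - ?D (\<lambda>_. 1) z) \<in> L2"
        by (intro L2_diff L2_scale H L2_plusD(1)[OF commutator_L2_plus] L2_plusD(1)[OF one]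
            conjunct1[OF Hs_wiener[OF s Hs_plusD(1)[OF u]]])
      then have "l2norm (\<lambda>z. 1 / of_real r * (u (t + r) z - u t z) - szego_field (u t) z) =
          l2norm (\<lambda>z. (hankel (u (t + r)) (\<lambda>_. 1) z - hankel (u t) (\<lambda>_. 1) z) / of_real r - ?D (\<lambda>_. 1) z)"
        by (intro l2norm_cong_AE[OF _ _ ae, symmetric])
           (use L2_measurable[OF w, of r] in \<open>auto intro: L2_measurable\<close>)
      also have "\<dots> \<le> e / 2"
        using elim one l2_one by fastforce
      finally have "cmod (fourier (\<lambda>z. 1 / of_real r * (u (t + r) z - u t z) - szego_field (u t) z) k) \<le> e / 2"
        using norm_fourier_le[OF w, of r k] by simp
      also have "fourier (\<lambda>z. 1 / of_real r * (u (t + r) z - u t z) - szego_field (u t) z) k =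
          (fourier (u (t + r)) k - fourier (u t) k) / of_real r - fourier (szego_field (u t)) k"
        unfolding fourier_diff[OF L2_scale[OF L2_diff[OF L2_plusD(1)[OF uL] L2_plusD(1)[OF uL]]] L2_plusD(1)[OF F]]
          fourier_scale
        by (simp add: fourier_diff L2_plusD(1)[OF uL])
      finally show ?case using e by simp
    qed
  qed
  then show ?thesis by (rule LIM_zero_cancel)
qed

text \<open>
  Pairing with \<open>c\<close>, the coefficients of the error itself, reduces the estimate in \<open>H\<^sup>s\<close> to the mean
  value theorem for a real function, so that no vector-valued integral is needed.
\<close>

lemma difference_quotient_sum_le:
  fixes a b :: "real \<Rightarrow> int \<Rightarrow> complex" and \<omega> :: "int \<Rightarrow> real"
  assumes \<omega>: "\<And>k. \<omega> k \<ge> 0"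
    and deriv: "\<And>\<tau> k. ((\<lambda>r. (a (\<tau> + r) k - a \<tau> k) / of_real r) \<longlongrightarrow> b \<tau> k) (at 0)"
    and bound: "\<And>\<xi>. \<xi> \<noteq> t \<Longrightarrow> \<bar>\<xi> - t\<bar> < \<bar>r\<bar> \<Longrightarrow> (\<Sum>k\<in>K. \<omega> k * (cmod (b \<xi> k - b t k))\<^sup>2) \<le> E"
    and r: "r \<noteq> 0"
  shows "(\<Sum>k\<in>K. \<omega> k * (cmod ((a (t + r) k - a t k) / of_real r - b t k))\<^sup>2) \<le> E"
proof -
  define c where "c k = (a (t + r) k - a t k) / of_real r - b t k" for k
  \<comment> \<open>The coefficients \<open>c\<close> stay fixed while \<open>\<tau>\<close> varies.
    Subtracting the linear motion with velocity \<open>b t k\<close> makes the increment of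
    \<open>\<psi>\<close> from t to t + r equal to r times the sum to be bounded.\<close>
  define \<psi> where "\<psi> \<tau> = (\<Sum>k\<in>K. \<omega> k * Re (cnj (c k) * (a \<tau> k - of_real \<tau> * b t k)))" for \<tau>
  define \<psi>' where "\<psi>' \<tau> = (\<Sum>k\<in>K. \<omega> k * Re (cnj (c k) * (b \<tau> k - b t k)))" for \<tau>
  have der: "DERIV \<psi> \<tau> :> \<psi>' \<tau>" for \<tau>
    unfolding DERIV_def
  proof (rule Lim_transform_eventually)
    show "((\<lambda>h. \<Sum>k\<in>K. \<omega> k * Re (cnj (c k) * ((a (\<tau> + h) k - a \<tau> k) / of_real h - b t k))) \<longlongrightarrow> \<psi>' \<tau>) (at 0)"
      unfolding \<psi>'_def by (intro tendsto_intros deriv)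
    show "\<forall>\<^sub>F h in at 0. (\<Sum>k\<in>K. \<omega> k * Re (cnj (c k) * ((a (\<tau> + h) k - a \<tau> k) / of_real h - b t k))) =
        (\<psi> (\<tau> + h) - \<psi> \<tau>) / h"
    proof (rule eventually_mono[OF eventually_neq_at_within[of 0]])
      fix h :: real assume h: "h \<noteq> 0"
      have "\<omega> k * Re (cnj (c k) * ((a (\<tau> + h) k - a \<tau> k) / of_real h - b t k)) =
          (\<omega> k * Re (cnj (c k) * (a (\<tau> + h) k - of_real (\<tau> + h) * b t k)) -
           \<omega> k * Re (cnj (c k) * (a \<tau> k - of_real \<tau> * b t k))) / h" for k
      proof -
        have "(a (\<tau> + h) k - a \<tau> k) / of_real h - b t k =
            ((a (\<tau> + h) k - of_real (\<tau> + h) * b t k) - (a \<tau> k - of_real \<tau> * b t k)) / of_real h"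
          using h by (simp add: field_simps)
        then have "cnj (c k) * ((a (\<tau> + h) k - a \<tau> k) / of_real h - b t k) =
            (cnj (c k) * (a (\<tau> + h) k - of_real (\<tau> + h) * b t k) - cnj (c k) * (a \<tau> k - of_real \<tau> * b t k)) / of_real h"
          by (simp only: right_diff_distrib[symmetric] times_divide_eq_right)
        then show ?thesis
          by (simp only: Re_divide_of_real minus_complex.simps right_diff_distrib times_divide_eq_right)
      qed
      then show "(\<Sum>k\<in>K. \<omega> k * Re (cnj (c k) * ((a (\<tau> + h) k - a \<tau> k) / of_real h - b t k))) =
          (\<psi> (\<tau> + h) - \<psi> \<tau>) / h"
        unfolding \<psi>_def by (simp only: sum_subtractf[symmetric] sum_divide_distrib)
    qed
  qed
  \<comment> \<open>The mean value theorem is applied on an increasing interval, hence the two signs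
    of \<open>r\<close>. The point is strictly inside, so that only the punctured neighbourhood of
    \<open>t\<close> matters for \<open>bound\<close>.\<close>
  have "\<exists>\<xi>. \<xi> \<noteq> t \<and> \<bar>\<xi> - t\<bar> < \<bar>r\<bar> \<and> \<psi> (t + r) - \<psi> t = r * \<psi>' \<xi>"
  proof (cases "r > 0")
    case True
    then show ?thesis using MVT2[of t "t + r" \<psi> \<psi>'] der by force
  next
    case False
    with r obtain \<xi> where "t + r < \<xi>" "\<xi> < t" "\<psi> t - \<psi> (t + r) = (t - (t + r)) * \<psi>' \<xi>"
      using MVT2[of "t + r" t \<psi> \<psi>'] der by auto
    with False show ?thesis by (intro exI[of _ \<xi>]) auto
  qed
  then obtain \<xi> where \<xi>: "\<xi> \<noteq> t" "\<bar>\<xi> - t\<bar> < \<bar>r\<bar>" "\<psi> (t + r) - \<psi> t = r * \<psi>' \<xi>"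
    by blast
  define S where "S = (\<Sum>k\<in>K. \<omega> k * (cmod (c k))\<^sup>2)"
  have "\<psi> (t + r) - \<psi> t = r * S"
    unfolding \<psi>_def S_def sum_subtractf[symmetric] sum_distrib_left
  proof (rule sum.cong[OF refl])
    fix k
    have "(a (t + r) k - of_real (t + r) * b t k) - (a t k - of_real t * b t k) = of_real r * c k"
      using r by (simp add: c_def field_simps)
    then have "cnj (c k) * (a (t + r) k - of_real (t + r) * b t k) - cnj (c k) * (a t k - of_real t * b t k) =
        of_real (r * (cmod (c k))\<^sup>2)"
      by (simp only: right_diff_distrib[symmetric] of_real_mult complex_norm_square mult_ac)
    then have "Re (cnj (c k) * (a (t + r) k - of_real (t + r) * b t k)) - Re (cnj (c k) * (a t k - of_real t * b t k)) =
        r * (cmod (c k))\<^sup>2"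
      by (simp only: minus_complex.simps[symmetric] Re_complex_of_real)
    then show "\<omega> k * Re (cnj (c k) * (a (t + r) k - of_real (t + r) * b t k)) -
        \<omega> k * Re (cnj (c k) * (a t k - of_real t * b t k)) = r * (\<omega> k * (cmod (c k))\<^sup>2)"
      by (simp only: right_diff_distrib[symmetric] mult.left_commute)
  qed
  with \<xi>(3) r have "S = \<psi>' \<xi>" by simp
  \<comment> \<open>x y <= x^2 / 2 + y^2 / 2 puts S / 2 on the right, which is absorbed into
    \<open>S\<close> on the left.\<close>
  also have "\<psi>' \<xi> \<le> (\<Sum>k\<in>K. \<omega> k * ((cmod (c k))\<^sup>2 / 2 + (cmod (b \<xi> k - b t k))\<^sup>2 / 2))"
    unfolding \<psi>'_def
  proof (intro sum_mono mult_left_mono \<omega>)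
    fix k
    have "Re (cnj (c k) * (b \<xi> k - b t k)) \<le> cmod (c k) * cmod (b \<xi> k - b t k)"
      using complex_Re_le_cmod[of "cnj (c k) * (b \<xi> k - b t k)"] by (simp add: norm_mult)
    also have "\<dots> \<le> (cmod (c k))\<^sup>2 / 2 + (cmod (b \<xi> k - b t k))\<^sup>2 / 2"
      using sum_squares_bound[of "cmod (c k)" "cmod (b \<xi> k - b t k)"] by simp
    finally show "Re (cnj (c k) * (b \<xi> k - b t k)) \<le> (cmod (c k))\<^sup>2 / 2 + (cmod (b \<xi> k - b t k))\<^sup>2 / 2" .
  qed
  also have "\<dots> = S / 2 + (\<Sum>k\<in>K. \<omega> k * (cmod (b \<xi> k - b t k))\<^sup>2) / 2"
    unfolding S_def by (simp add: ring_distribs sum.distrib sum_divide_distrib)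
  also have "\<dots> \<le> S / 2 + E / 2"
    using bound[OF \<xi>(1,2)] by simp
  finally show ?thesis by (simp add: S_def c_def)
qed

text \<open>A single \<open>\<delta>\<close>, obtained from the continuity of the cubic term at
  \<open>t\<close>, serves all finite sets of frequencies at once, which is the uniformity that
  \<open>HsI\<close> demands.\<close>

lemma lax_imp_cubic_szego:
  assumes s: "s > 1 / 2" and uC: "u \<in> C_Hs_plus s"
    and lax: "\<And>t. has_op_derivative (\<lambda>\<tau>. hankel (u \<tau>)) (commutator (B_op (u t)) (hankel (u t))) t"
  shows "has_Hs_derivative s u (szego_field (u t)) t"
proof -
  have u: "u t \<in> Hs_plus s" for t using uC by (simp add: C_Hs_plus_def)
  note uH = Hs_plusD(1)[OF u]
  define F where "F \<tau> = szego_field (u \<tau>)" for \<tau>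
  define c where "c \<tau> w = of_real ((cmod (u \<tau> w))\<^sup>2) * u \<tau> w" for \<tau> w
  have cH: "c \<tau> \<in> Hs s" for \<tau>
    unfolding c_def[abs_def] by (rule Hs_cubic[OF s uH])
  have F: "F \<tau> \<in> Hs_plus s" for \<tau>
    unfolding F_def by (rule szego_field_Hs_plus[OF s uH])
  have cont: "((\<lambda>\<tau>. hs_norm s (\<lambda>z. c \<tau> z - c t z)) \<longlongrightarrow> 0) (at t)"
    unfolding c_def using uC by (intro tendsto_hs_norm_cubic s uH) (simp add: C_Hs_plus_def)
  \<comment> \<open>The coefficients of \<open>F\<close> are those of \<open>c\<close> times - i,
    cut off to k >= 0, so their differences are no larger than those of \<open>c\<close>.\<close>
  have sum_le: "(\<Sum>k\<in>K. weight s k * (cmod (fourier (F \<xi>) k - fourier (F t) k))\<^sup>2) \<le>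
      (hs_norm s (\<lambda>z. c \<xi> z - c t z))\<^sup>2" if K: "finite K" for K \<xi>
  proof -
    have field: "fourier (F \<tau>) k = (if k \<ge> 0 then - \<i> * fourier (c \<tau>) k else 0)" for \<tau> k
      unfolding F_def c_def[abs_def] by (rule fourier_szego_field[OF s uH])
    have "cmod (fourier (F \<xi>) k - fourier (F t) k) \<le> cmod (fourier (\<lambda>z. c \<xi> z - c t z) k)" for k
      by (simp only: field fourier_diff[OF Hs_L2[OF cH] Hs_L2[OF cH]])
         (simp add: norm_mult norm_minus_commute del: mult_minus_left flip: right_diff_distrib)
    then have "(\<Sum>k\<in>K. weight s k * (cmod (fourier (F \<xi>) k - fourier (F t) k))\<^sup>2) \<le>
        (\<Sum>k\<in>K. weight s k * (cmod (fourier (\<lambda>z. c \<xi> z - c t z) k))\<^sup>2)"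
      by (intro sum_mono mult_left_mono power_mono) auto
    also have "\<dots> \<le> (hs_norm s (\<lambda>z. c \<xi> z - c t z))\<^sup>2"
      by (intro Hs_sum_le Hs_diff cH K)
    finally show ?thesis .
  qed
  have "((\<lambda>r. hs_norm s (\<lambda>z. (u (t + r) z - u t z) / of_real r - F t z)) \<longlongrightarrow> 0) (at 0)"
  proof (rule tendstoI)
    fix e :: real assume e: "e > 0"
    then have "\<forall>\<^sub>F \<tau> in at t. hs_norm s (\<lambda>z. c \<tau> z - c t z) < e / 2"
      using cont by (intro order_tendstoD(2)) auto
    then obtain \<delta> where \<delta>: "\<delta> > 0"
        "\<And>\<xi>. \<xi> \<noteq> t \<Longrightarrow> \<bar>\<xi> - t\<bar> < \<delta> \<Longrightarrow> hs_norm s (\<lambda>z. c \<xi> z - c t z) < e / 2"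
      unfolding eventually_at by (auto simp: dist_real_def)
    show "\<forall>\<^sub>F r in at 0. dist (hs_norm s (\<lambda>z. (u (t + r) z - u t z) / of_real r - F t z)) 0 < e"
      unfolding eventually_at
    proof (intro exI[of _ \<delta>] conjI ballI impI \<delta>(1))
      fix r :: real assume "r \<noteq> 0 \<and> dist r 0 < \<delta>"
      then have r: "r \<noteq> 0" "\<bar>r\<bar> < \<delta>" by auto
      note L = L2_diff[OF Hs_L2[OF uH[of "t + r"]] Hs_L2[OF uH[of t]]] Hs_L2[OF Hs_plusD(1)[OF F[of t]]]
      have eq: "(\<lambda>z. (u (t + r) z - u t z) / of_real r - F t z) =
          (\<lambda>z. 1 / of_real r * (u (t + r) z - u t z) - F t z)" by simp
      have "hs_norm s (\<lambda>z. (u (t + r) z - u t z) / of_real r - F t z) \<le> e / 2"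
      proof (rule conjunct2[OF HsI])
        show "(\<lambda>z. (u (t + r) z - u t z) / of_real r - F t z) \<in> L2"
          unfolding eq by (intro L2_diff[OF L2_scale] L)
        fix K :: "int set" assume K: "finite K"
        have coef: "fourier (\<lambda>z. (u (t + r) z - u t z) / of_real r - F t z) k =
            (fourier (u (t + r)) k - fourier (u t) k) / of_real r - fourier (F t) k" for k
          unfolding eq fourier_diff[OF L2_scale[OF L(1)] L(2)] fourier_scale
          by (simp add: fourier_diff Hs_L2[OF uH])
        show "(\<Sum>k\<in>K. weight s k * (cmod (fourier (\<lambda>z. (u (t + r) z - u t z) / of_real r - F t z) k))\<^sup>2) \<le> (e / 2)\<^sup>2"
          unfolding coef
        proof (rule difference_quotient_sum_le)
          \<comment> \<open>The Lax equation enters at every time \<open>\<tau>\<close>, not only at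
            \<open>t\<close>, because the mean value point is not under control.\<close>
          show "((\<lambda>r. (fourier (u (\<tau> + r)) k - fourier (u \<tau>) k) / of_real r) \<longlongrightarrow> fourier (F \<tau>) k) (at 0)" for \<tau> k
            unfolding F_def by (rule lax_imp_fourier_derivative[OF s u lax])
          fix \<xi> assume \<xi>: "\<xi> \<noteq> t" "\<bar>\<xi> - t\<bar> < \<bar>r\<bar>"
          have "(hs_norm s (\<lambda>z. c \<xi> z - c t z))\<^sup>2 \<le> (e / 2)\<^sup>2"
            using \<delta>(2)[OF \<xi>(1)] \<xi>(2) r by (intro power_mono) auto
          with sum_le[OF K, of \<xi>]
          show "(\<Sum>k\<in>K. weight s k * (cmod (fourier (F \<xi>) k - fourier (F t) k))\<^sup>2) \<le> (e / 2)\<^sup>2"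
            by simp
        qed (use r in auto)
      qed (use e in simp)
      then show "dist (hs_norm s (\<lambda>z. (u (t + r) z - u t z) / of_real r - F t z)) 0 < e"
        using e by simp
    qed
  qed
  then show ?thesis using F[of t] by (simp add: has_Hs_derivative_def F_def)
qed

theorem theorem3p1:
  fixes s :: real and u :: "real \<Rightarrow> complex \<Rightarrow> complex"
  assumes "s > 1 / 2"
    and "u \<in> C_Hs_plus s"
  shows "(cubic_szego_solution s u \<longleftrightarrow>
      (\<forall>t. has_op_derivative (\<lambda>\<tau>. hankel (u \<tau>)) (commutator (B_op (u t)) (hankel (u t))) t))
    \<and> (\<forall>t. skew_symmetric_op (B_op (u t)))"
proof (intro conjI iffI allI)
  have u: "u t \<in> Hs_plus s" for t using assms(2) by (simp add: C_Hs_plus_def)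
  show "has_op_derivative (\<lambda>\<tau>. hankel (u \<tau>)) (commutator (B_op (u t)) (hankel (u t))) t"
    if "cubic_szego_solution s u" for t
    using that cubic_szego_imp_lax[of s u, OF assms(1) u] unfolding cubic_szego_solution_def by blast
  show "cubic_szego_solution s u"
    if "\<forall>t. has_op_derivative (\<lambda>\<tau>. hankel (u \<tau>)) (commutator (B_op (u t)) (hankel (u t))) t"
    unfolding cubic_szego_solution_def
  \<comment> \<open>The derivative is taken to be \<open>szego_field (u t)\<close>, the equation
    solved for the time derivative; the second condition then holds at every point.\<close>
  proof (intro allI exI conjI)
    fix t
    show "has_Hs_derivative s u (szego_field (u t)) t"
      using that by (intro lax_imp_cubic_szego assms) blast
    show "AE z in circ. \<i> * szego_field (u t) z = szego_proj (\<lambda>w. of_real ((cmod (u t w))\<^sup>2) * u t w) z"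
      by (simp add: szego_field_def flip: mult.assoc)
  qed
  show "skew_symmetric_op (B_op (u t))" for t
    using Hs_wiener[OF assms(1) Hs_plusD(1)[OF u]] by (intro skew_symmetric_B_op) simp
qed

end
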